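(* The bigraded Hopf algebra $\mathrm{DNSym}$ is isomorphic to the bigraded Hopf dual algebra $\mathrm{DQSym}^*=\bigoplus_{(d_1,d_2)}\bigl(\mathrm{DQSym}^{(d_1,d_2)}\bigr)^*$ of $\mathrm{DQSym}$.
   Context: All vector spaces are over $\mathbb{Q}$, and $0\in\mathbb{N}$. Definition of $\mathrm{DNSym}$. $\mathrm{DNSym}:=\mathbb{Q}\langle \mathfrak h_\alpha\mid \alpha\in\mathbb{N}^2\setminus\{0\}\rangle$ is the free associative (noncommutative) unital algebra on variables $\mathfrak h_\alpha$, bigraded by giving $\mathfrak h_\alpha$ bidegree $\alpha=(a,b)$. With the convention $\mathfrak h_0:=1$, its comultiplication is the algebra morphism determined by $$\Delta(\mathfrak h_\alpha)=\sum_{\alpha=\beta+\gamma}\mathfrak h_\beta\otimes\mathfrak h_\gamma,$$ the sum being over all pairs $\beta,\gamma\in\mathbb{N}^2$ with vector sum $\alpha$, and its counit is the algebra morphism determined by $\epsilon(\mathfrak h_\alpha)=1$ if $\alpha=0$ and $0$ otherwise. This makes $\mathrm{DNSym}$ a bigraded Hopf algebra. Definition of $\mathrm{DQSym}$. A bicomposition of length $k$ is a sequence $\mathfrak a=(\alpha_1,\dots,\alpha_k)$ of nonzero vectors $\alpha_m=(a_m,b_m)\in\mathbb{N}^2$; the empty bicomposition, of length $0$, is denoted $0$. The bidegree of $\mathfrak a$ is $d(\mathfrak a)=(a_1+\dots+a_k,\;b_1+\dots+b_k)$. Concatenation is $(\alpha_1,\dots,\alpha_k)\cdot(\beta_1,\dots,\beta_\ell)=(\alpha_1,\dots,\alpha_k,\beta_1,\dots,\beta_\ell)$.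 In two infinite sets of commuting variables $x_1,x_2,\dots$ and $y_1,y_2,\dots$, define the formal series $$M_{\mathfrak a}=\sum_{i_1<i_2<\dots<i_k} x_{i_1}^{a_1}y_{i_1}^{b_1}\cdots x_{i_k}^{a_k}y_{i_k}^{b_k},\qquad M_0=1.$$ $\mathrm{DQSym}$ is the vector space with basis $\{M_{\mathfrak a}\}$, $\mathfrak a$ running over all bicompositions, with the usual multiplication of formal series (under which it is closed), unit $M_0=1$, comultiplication $\Delta(M_{\mathfrak a})=\sum_{\mathfrak a_1\cdot\mathfrak a_2=\mathfrak a}M_{\mathfrak a_1}\otimes M_{\mathfrak a_2}$ (sum over all factorizations, including those with an empty factor), and counit $\epsilon(M_{\mathfrak a})=1$ if $\mathfrak a=0$ and $0$ otherwise. It is a bigraded Hopf algebra, $M_{\mathfrak a}$ having bidegree $d(\mathfrak a)$; its bihomogeneous component $\mathrm{DQSym}^{(d_1,d_2)}$ is the finite-dimensional span of the $M_{\mathfrak a}$ with $d(\mathfrak a)=(d_1,d_2)$. The bigraded Hopf dual $\mathrm{DQSym}^*$ is the direct sum of the linear duals of the bihomogeneous components, with multiplication dual to the comultiplication of $\mathrm{DQSym}$ and comultiplication dual to the multiplication of $\mathrm{DQSym}$. "Isomorphic" means isomorphic as bigraded Hopf algebras. *)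

theory Defs
  imports
    Complex_Main
    "HOL-Library.Poly_Mapping"
    "HOL-Library.Function_Algebras"
    "HOL-Library.Product_Plus"
begin

class rat_vector = ab_group_add +
  fixes scaleQ :: "rat \<Rightarrow> 'a \<Rightarrow> 'a" (infixr "*Q" 75)
  assumes scaleQ_add_right: "r *Q (x + y) = r *Q x + r *Q y"
    and scaleQ_add_left: "(r + s) *Q x = r *Q x + s *Q x"
    and scaleQ_scaleQ: "r *Q (s *Q x) = (r * s) *Q x"
    and scaleQ_one: "1 *Q x = x"

global_interpretation Q: vector_space "scaleQ :: rat \<Rightarrow> 'a \<Rightarrow> 'a :: rat_vector"
  by standard (fact scaleQ_add_right scaleQ_add_left scaleQ_scaleQ scaleQ_one)+

global_interpretation QQ: vector_space_pair
  "scaleQ :: rat \<Rightarrow> 'a \<Rightarrow> 'a :: rat_vector" "scaleQ :: rat \<Rightarrow> 'b \<Rightarrow> 'b :: rat_vector"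
  by standard

abbreviation linearQ :: "('a::rat_vector \<Rightarrow> 'b::rat_vector) \<Rightarrow> bool"
  where "linearQ \<equiv> Vector_Spaces.linear scaleQ scaleQ"

lemma linearQI:
  assumes "\<And>x y. f (x + y) = f x + f y" "\<And>r x. f (r *Q x) = r *Q f x"
  shows "linearQ f"
  using assms by (simp add: Vector_Spaces.linear_iff Q.vector_space_axioms)

lemma linearQD:
  assumes "linearQ f"
  shows "f (x + y) = f x + f y" "f (r *Q x) = r *Q f x" "f 0 = 0" "f (- x) = - f x" "f (x - y) = f x - f y"
  using assms by (simp_all add: QQ.linear_add QQ.linear_scale QQ.linear_0 QQ.linear_neg QQ.linear_diff)

definition bilinearQ :: "('a::rat_vector \<Rightarrow> 'b::rat_vector \<Rightarrow> 'c::rat_vector) \<Rightarrow> bool"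
  where "bilinearQ B \<longleftrightarrow> (\<forall>a. linearQ (B a)) \<and> (\<forall>b. linearQ (\<lambda>a. B a b))"

instantiation rat :: rat_vector
begin
definition scaleQ_rat :: "rat \<Rightarrow> rat \<Rightarrow> rat" where "scaleQ_rat r x = r * x"
instance by standard (simp_all add: scaleQ_rat_def algebra_simps)
end

instantiation "fun" :: (type, rat_vector) rat_vector
begin
definition scaleQ_fun :: "rat \<Rightarrow> ('a \<Rightarrow> 'b) \<Rightarrow> 'a \<Rightarrow> 'b" where "scaleQ_fun r f = (\<lambda>x. r *Q f x)"
instance by standard
    (simp_all add: scaleQ_fun_def fun_eq_iff scaleQ_add_right scaleQ_add_left scaleQ_scaleQ scaleQ_one)
end

instantiation poly_mapping :: (type, rat_vector) rat_vector
begin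
lift_definition scaleQ_poly_mapping :: "rat \<Rightarrow> ('a \<Rightarrow>\<^sub>0 'b) \<Rightarrow> ('a \<Rightarrow>\<^sub>0 'b)"
  is "\<lambda>r f k. r *Q f k"
  by (erule rev_finite_subset) auto
instance by standard
    (transfer; simp add: fun_eq_iff scaleQ_add_right scaleQ_add_left scaleQ_scaleQ scaleQ_one)+
end

lemma lookup_scaleQ [simp]: "Poly_Mapping.lookup (r *Q p) k = r *Q Poly_Mapping.lookup p k"
  by transfer simp

text \<open>The linear map out of the free vector space on \<open>'k\<close> prescribed on its basis.\<close>

definition lin_ext :: "('k \<Rightarrow> 'a::rat_vector) \<Rightarrow> ('k \<Rightarrow>\<^sub>0 rat) \<Rightarrow> 'a"
  where "lin_ext g p = (\<Sum>k\<in>Poly_Mapping.keys p. Poly_Mapping.lookup p k *Q g k)"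

lemma lin_ext_superset:
  assumes "finite K" "Poly_Mapping.keys p \<subseteq> K"
  shows "lin_ext g p = (\<Sum>k\<in>K. Poly_Mapping.lookup p k *Q g k)"
  unfolding lin_ext_def using assms by (intro sum.mono_neutral_left) (auto simp: in_keys_iff)

lemma linear_lin_ext: "linearQ (lin_ext g)"
proof (rule linearQI)
  fix p q :: "'a \<Rightarrow>\<^sub>0 rat" and r :: rat
  let ?K = "Poly_Mapping.keys p \<union> Poly_Mapping.keys q"
  have "lin_ext g (p + q) = (\<Sum>k\<in>?K. Poly_Mapping.lookup (p + q) k *Q g k)"
    by (rule lin_ext_superset) (auto dest: subsetD[OF Poly_Mapping.keys_add])
  also have "\<dots> = (\<Sum>k\<in>?K. Poly_Mapping.lookup p k *Q g k) + (\<Sum>k\<in>?K. Poly_Mapping.lookup q k *Q g k)"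
    by (simp add: lookup_add scaleQ_add_left sum.distrib)
  also have "\<dots> = lin_ext g p + lin_ext g q"
    by (simp add: lin_ext_superset[of ?K])
  finally show "lin_ext g (p + q) = lin_ext g p + lin_ext g q" .
  have "lin_ext g (r *Q p) = (\<Sum>k\<in>Poly_Mapping.keys p. Poly_Mapping.lookup (r *Q p) k *Q g k)"
    by (rule lin_ext_superset) (auto simp: in_keys_iff)
  also have "\<dots> = r *Q lin_ext g p"
    by (simp add: lin_ext_def Q.scale_sum_right scaleQ_scaleQ scaleQ_rat_def)
  finally show "lin_ext g (r *Q p) = r *Q lin_ext g p" .
qed

lemma lin_ext_single [simp]: "lin_ext g (Poly_Mapping.single k r) = r *Q g k"
  by (simp add: lin_ext_def)

definition tensor_relations :: "('a::rat_vector \<times> 'b::rat_vector \<Rightarrow>\<^sub>0 rat) set"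
  where "tensor_relations = Q.span (
    {Poly_Mapping.single (a + a', b) 1 - Poly_Mapping.single (a, b) 1 - Poly_Mapping.single (a', b) 1 |a a' b. True} \<union>
    {Poly_Mapping.single (a, b + b') 1 - Poly_Mapping.single (a, b) 1 - Poly_Mapping.single (a, b') 1 |a b b'. True} \<union>
    {Poly_Mapping.single (r *Q a, b) 1 - r *Q Poly_Mapping.single (a, b) 1 |r a b. True} \<union>
    {Poly_Mapping.single (a, r *Q b) 1 - r *Q Poly_Mapping.single (a, b) 1 |r a b. True})"

lemma subspace_tensor_relations: "Q.subspace tensor_relations"
  by (simp add: tensor_relations_def)

lemmas tensor_relations_closed =
  Q.subspace_0[OF subspace_tensor_relations] Q.subspace_add[OF subspace_tensor_relations]
  Q.subspace_neg[OF subspace_tensor_relations] Q.subspace_diff[OF subspace_tensor_relations]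
  Q.subspace_scale[OF subspace_tensor_relations]

quotient_type (overloaded) ('a, 'b) tensor = "'a::rat_vector \<times> 'b::rat_vector \<Rightarrow>\<^sub>0 rat"
  / "\<lambda>p q. p - q \<in> tensor_relations"
proof (rule equivpI)
  show "reflp (\<lambda>p q. p - q \<in> tensor_relations)"
    by (simp add: reflp_def tensor_relations_closed)
  show "symp (\<lambda>p q. p - q \<in> tensor_relations)"
    by (rule sympI) (drule tensor_relations_closed(3), simp)
  show "transp (\<lambda>p q. p - q \<in> tensor_relations)"
    by (rule transpI) (drule (1) tensor_relations_closed(2), simp)
qed

instantiation tensor :: (rat_vector, rat_vector) rat_vector
begin
lift_definition zero_tensor :: "('a, 'b) tensor" is 0 .
lift_definition plus_tensor :: "('a, 'b) tensor \<Rightarrow> ('a, 'b) tensor \<Rightarrow> ('a, 'b) tensor" is "(+)"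
  by (subst add_diff_add) (rule tensor_relations_closed)
lift_definition uminus_tensor :: "('a, 'b) tensor \<Rightarrow> ('a, 'b) tensor" is uminus
  by (subst minus_diff_minus) (rule tensor_relations_closed)
lift_definition minus_tensor :: "('a, 'b) tensor \<Rightarrow> ('a, 'b) tensor \<Rightarrow> ('a, 'b) tensor" is "(-)"
  by (drule (1) tensor_relations_closed(4)) (simp add: algebra_simps)
lift_definition scaleQ_tensor :: "rat \<Rightarrow> ('a, 'b) tensor \<Rightarrow> ('a, 'b) tensor" is scaleQ
  by (subst Q.scale_right_diff_distrib[symmetric]) (rule tensor_relations_closed)
instance
  by standard (transfer; simp add: tensor_relations_closed algebra_simps
    scaleQ_add_right scaleQ_add_left scaleQ_scaleQ scaleQ_one)+
end

lift_definition tensor_pure :: "'a::rat_vector \<Rightarrow> 'b::rat_vector \<Rightarrow> ('a, 'b) tensor" (infixr "\<otimes>" 70)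
  is "\<lambda>a b. Poly_Mapping.single (a, b) 1" .

text \<open>The linear map on the tensor product induced by \<open>B\<close>.  It is evaluated on a chosen representative,
  so it is meaningful only for bilinear \<open>B\<close>.\<close>

definition tensor_lift :: "('a::rat_vector \<Rightarrow> 'b::rat_vector \<Rightarrow> 'c::rat_vector) \<Rightarrow> ('a, 'b) tensor \<Rightarrow> 'c"
  where "tensor_lift B t = lin_ext (case_prod B) (rep_tensor t)"

lemma tensor_lift_abs:
  assumes B: "bilinearQ B"
  shows "tensor_lift B (abs_tensor p) = lin_ext (case_prod B) p"
proof -
  have B1: "linearQ (B a)" and B2: "linearQ (\<lambda>a. B a b)" for a b
    using B by (auto simp: bilinearQ_def)
  have rel: "lin_ext (case_prod B) q = 0" if "q \<in> tensor_relations" for q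
    using that unfolding tensor_relations_def
  proof (induction rule: Q.span_induct)
    case base
    show ?case
      by (auto intro!: Q.subspaceI simp: linearQD[OF linear_lin_ext])
  next
    case (step x)
    then show ?case
      by (auto simp: linearQD[OF linear_lin_ext] scaleQ_one linearQD[OF B1] linearQD[OF B2])
  qed
  have "rep_tensor (abs_tensor p) - p \<in> tensor_relations"
    using Quotient_abs_rep[OF Quotient_tensor, of "abs_tensor p"] by (simp add: tensor.abs_eq_iff)
  from rel[OF this] show ?thesis
    by (simp add: tensor_lift_def linearQD[OF linear_lin_ext])
qed

lemma tensor_lift_pure: "bilinearQ B \<Longrightarrow> tensor_lift B (a \<otimes> b) = B a b"
  by (simp add: tensor_pure_def tensor_lift_abs scaleQ_one)

lemma linear_tensor_lift:
  assumes "bilinearQ B" shows "linearQ (tensor_lift B)"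
proof (rule linearQI)
  fix s t :: "('a, 'b) tensor" and r :: rat
  obtain p q where "s = abs_tensor p" "t = abs_tensor q"
    by (metis Quotient_abs_rep[OF Quotient_tensor])
  then show "tensor_lift B (s + t) = tensor_lift B s + tensor_lift B t"
    "tensor_lift B (r *Q s) = r *Q tensor_lift B s"
    by (simp_all add: plus_tensor.abs_eq scaleQ_tensor.abs_eq tensor_lift_abs assms
        linearQD[OF linear_lin_ext])
qed

definition tensor_map ::
  "('a::rat_vector \<Rightarrow> 'c::rat_vector) \<Rightarrow> ('b::rat_vector \<Rightarrow> 'd::rat_vector) \<Rightarrow> ('a, 'b) tensor \<Rightarrow> ('c, 'd) tensor"
  where "tensor_map f g = tensor_lift (\<lambda>a b. f a \<otimes> g b)"

definition tensor_assoc ::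
  "(('a::rat_vector, 'b::rat_vector) tensor, 'c::rat_vector) tensor \<Rightarrow> ('a, ('b, 'c) tensor) tensor"
  where "tensor_assoc = tensor_lift (\<lambda>t c. tensor_lift (\<lambda>a b. a \<otimes> (b \<otimes> c)) t)"

definition tensor_mult :: "('a::rat_vector \<Rightarrow> 'a \<Rightarrow> 'a) \<Rightarrow> ('b::rat_vector \<Rightarrow> 'b \<Rightarrow> 'b) \<Rightarrow>
    ('a, 'b) tensor \<Rightarrow> ('a, 'b) tensor \<Rightarrow> ('a, 'b) tensor"
  where "tensor_mult m n s t = tensor_lift (\<lambda>a b. tensor_lift (\<lambda>c d. m a c \<otimes> n b d) t) s"

record (overloaded) ('a::rat_vector) bihopf =
  hmult :: "'a \<Rightarrow> 'a \<Rightarrow> 'a"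
  hunit :: 'a
  hcomult :: "'a \<Rightarrow> ('a, 'a) tensor"
  hcounit :: "'a \<Rightarrow> rat"
  hcomp :: "nat \<times> nat \<Rightarrow> 'a set"

locale bigraded_hopf_algebra =
  fixes H :: "'a::rat_vector bihopf"
  assumes mult_bilinear: "bilinearQ (hmult H)"
    and mult_assoc: "hmult H (hmult H x y) z = hmult H x (hmult H y z)"
    and mult_unit: "hmult H (hunit H) x = x" "hmult H x (hunit H) = x"
    and comult_linear: "linearQ (hcomult H)"
    and counit_linear: "linearQ (hcounit H)"
    and coassoc: "tensor_assoc (tensor_map (hcomult H) id (hcomult H x)) = tensor_map id (hcomult H) (hcomult H x)"
    and counit_left: "tensor_lift (\<lambda>a b. hcounit H a *Q b) (hcomult H x) = x"
    and counit_right: "tensor_lift (\<lambda>a b. hcounit H b *Q a) (hcomult H x) = x"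
    and comult_mult: "hcomult H (hmult H x y) = tensor_mult (hmult H) (hmult H) (hcomult H x) (hcomult H y)"
    and comult_unit: "hcomult H (hunit H) = hunit H \<otimes> hunit H"
    and counit_mult: "hcounit H (hmult H x y) = hcounit H x * hcounit H y"
    and counit_unit: "hcounit H (hunit H) = 1"
    and comp_subspace: "Q.subspace (hcomp H d)"
    and comp_direct_sum: "\<exists>!c :: nat \<times> nat \<Rightarrow>\<^sub>0 'a. (\<forall>d. Poly_Mapping.lookup c d \<in> hcomp H d) \<and>
        x = (\<Sum>d\<in>Poly_Mapping.keys c. Poly_Mapping.lookup c d)"
    and comp_mult: "x \<in> hcomp H d \<Longrightarrow> y \<in> hcomp H e \<Longrightarrow> hmult H x y \<in> hcomp H (d + e)"
    and comp_unit: "hunit H \<in> hcomp H 0"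
    and comp_comult: "x \<in> hcomp H d \<Longrightarrow>
        hcomult H x \<in> Q.span {a \<otimes> b |a b. \<exists>e f. e + f = d \<and> a \<in> hcomp H e \<and> b \<in> hcomp H f}"
    and comp_counit: "x \<in> hcomp H d \<Longrightarrow> d \<noteq> 0 \<Longrightarrow> hcounit H x = 0"
    and antipode: "\<exists>S. linearQ S \<and> (\<forall>d. S ` hcomp H d \<subseteq> hcomp H d) \<and>
        (\<forall>x. tensor_lift (\<lambda>a b. hmult H (S a) b) (hcomult H x) = hcounit H x *Q hunit H) \<and>
        (\<forall>x. tensor_lift (\<lambda>a b. hmult H a (S b)) (hcomult H x) = hcounit H x *Q hunit H)"

text \<open>Compatibility with the antipodes is automatic for bialgebra morphisms between Hopf algebras.\<close>

definition bihopf_iso :: "'a::rat_vector bihopf \<Rightarrow> 'b::rat_vector bihopf \<Rightarrow> ('a \<Rightarrow> 'b) \<Rightarrow> bool"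
  where "bihopf_iso H K \<phi> \<longleftrightarrow>
    linearQ \<phi> \<and> bij \<phi> \<and>
    (\<forall>x y. \<phi> (hmult H x y) = hmult K (\<phi> x) (\<phi> y)) \<and>
    \<phi> (hunit H) = hunit K \<and>
    (\<forall>x. hcomult K (\<phi> x) = tensor_map \<phi> \<phi> (hcomult H x)) \<and>
    (\<forall>x. hcounit K (\<phi> x) = hcounit H x) \<and>
    (\<forall>d. \<phi> ` hcomp H d = hcomp K d)"

definition bihopf_isomorphic :: "'a::rat_vector bihopf \<Rightarrow> 'b::rat_vector bihopf \<Rightarrow> bool"
  where "bihopf_isomorphic H K \<longleftrightarrow>
    bigraded_hopf_algebra H \<and> bigraded_hopf_algebra K \<and> (\<exists>\<phi>. bihopf_iso H K \<phi>)"

typedef bicomp = "{w :: (nat \<times> nat) list. 0 \<notin> set w}"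
  morphisms bicomp_list Abs_bicomp
  by (rule exI[of _ "[]"]) simp

setup_lifting type_definition_bicomp

instantiation bicomp :: monoid_add
begin
lift_definition zero_bicomp :: bicomp is "[]" by simp
lift_definition plus_bicomp :: "bicomp \<Rightarrow> bicomp \<Rightarrow> bicomp" is "(@)" by simp
instance by standard (transfer; simp)+
end

definition bidegree :: "bicomp \<Rightarrow> nat \<times> nat"
  where "bidegree a = sum_list (bicomp_list a)"

text \<open>The free algebra is the monoid algebra of the free monoid on the nonzero vectors, whose words are the
  bicompositions; the product of \<open>bicomp \<Rightarrow>\<^sub>0 rat\<close> in the
  library is convolution along \<open>(+)\<close>, that is, along concatenation of words.\<close>

type_synonym dnsym = "bicomp \<Rightarrow>\<^sub>0 rat"

definition dn_h :: "nat \<times> nat \<Rightarrow> dnsym"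
  where "dn_h \<alpha> = (if \<alpha> = 0 then 1 else Poly_Mapping.single (Abs_bicomp [\<alpha>]) 1)"

definition dn_word :: "bicomp \<Rightarrow> dnsym"
  where "dn_word a = prod_list (map dn_h (bicomp_list a))"

definition dn_comult_h :: "nat \<times> nat \<Rightarrow> (dnsym, dnsym) tensor"
  where "dn_comult_h \<alpha> = (\<Sum>(\<beta>, \<gamma>) | \<beta> + \<gamma> = \<alpha>. dn_h \<beta> \<otimes> dn_h \<gamma>)"

text \<open>The algebra morphism with the given values on the generators.\<close>

definition dn_comult :: "dnsym \<Rightarrow> (dnsym, dnsym) tensor"
  where "dn_comult = lin_ext (\<lambda>a. foldr (tensor_mult (*) (*)) (map dn_comult_h (bicomp_list a)) (1 \<otimes> 1))"

definition dn_counit :: "dnsym \<Rightarrow> rat"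
  where "dn_counit = lin_ext (\<lambda>a. prod_list (map (\<lambda>\<alpha>. if \<alpha> = 0 then 1 else 0) (bicomp_list a)))"

definition DNSym :: "dnsym bihopf"
  where "DNSym = \<lparr>hmult = (*), hunit = 1, hcomult = dn_comult, hcounit = dn_counit,
    hcomp = (\<lambda>d. Q.span (dn_word ` {a. bidegree a = d}))\<rparr>"

text \<open>A monomial is given by its exponents: \<open>m\<close> stands for the product over \<open>i\<close> of
  \<open>x\<^sub>i ^ fst (m i) * y\<^sub>i ^ snd (m i)\<close>, the variables being numbered from \<open>0\<close>.  On series, viewed as functions of
  monomials, the library product \<open>(*)\<close> is pointwise; the product of formal series is \<open>series_mult\<close>.\<close>

type_synonym bimonomial = "nat \<Rightarrow>\<^sub>0 nat \<times> nat"

definition series_mult :: "(bimonomial \<Rightarrow> rat) \<Rightarrow> (bimonomial \<Rightarrow> rat) \<Rightarrow> (bimonomial \<Rightarrow> rat)"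
  where "series_mult f g m = (\<Sum>(p, q) | p + q = m. f p * g q)"

definition mono_of :: "nat list \<Rightarrow> (nat \<times> nat) list \<Rightarrow> bimonomial"
  where "mono_of is w = sum_list (map2 Poly_Mapping.single is w)"

text \<open>The coefficient of \<open>m\<close> in the sum over \<open>i\<^sub>1 < \<dots> < i\<^sub>k\<close> is the number of index sequences contributing \<open>m\<close>.\<close>

definition M_series :: "bicomp \<Rightarrow> bimonomial \<Rightarrow> rat"
  where "M_series a m = of_nat (card {is. length is = length (bicomp_list a) \<and> sorted_wrt (<) is \<and>
    mono_of is (bicomp_list a) = m})"

definition shape_list :: "bimonomial \<Rightarrow> (nat \<times> nat) list"
  where "shape_list m = map (Poly_Mapping.lookup m) (sorted_list_of_set (Poly_Mapping.keys m))"

lemma lookup_mono_of_notin: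
  "k \<notin> set is \<Longrightarrow> Poly_Mapping.lookup (mono_of is w) k = 0"
  unfolding mono_of_def
proof (induction "is" arbitrary: w)
  case (Cons i js)
  then show ?case by (cases w) (auto simp: lookup_add lookup_single)
qed simp

lemma map_lookup_mono_of:
  "distinct is \<Longrightarrow> length is = length w \<Longrightarrow> map (Poly_Mapping.lookup (mono_of is w)) is = w"
proof (induction "is" arbitrary: w)
  case (Cons i js)
  then obtain x v where w: "w = x # v" by (cases w) auto
  have eq: "mono_of (i # js) w = Poly_Mapping.single i x + mono_of js v"
    by (simp add: mono_of_def w)
  have "map (Poly_Mapping.lookup (mono_of (i # js) w)) js = map (Poly_Mapping.lookup (mono_of js v)) js"
    using Cons.prems by (auto simp: eq lookup_add lookup_single when_def)
  also have "\<dots> = v"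
    using Cons.prems w by (intro Cons.IH) auto
  finally have "map (Poly_Mapping.lookup (mono_of (i # js) w)) js = v" .
  moreover have "Poly_Mapping.lookup (mono_of (i # js) w) i = x"
    using Cons.prems by (simp add: eq lookup_add lookup_mono_of_notin)
  ultimately show ?case
    using w by simp
qed simp

lemma mono_of_map_lookup:
  assumes "distinct is" "Poly_Mapping.keys p \<subseteq> set is"
  shows "mono_of is (map (Poly_Mapping.lookup p) is) = p"
proof (rule poly_mapping_eqI)
  fix k
  let ?q = "mono_of is (map (Poly_Mapping.lookup p) is)"
  show "Poly_Mapping.lookup ?q k = Poly_Mapping.lookup p k"
  proof (cases "k \<in> set is")
    case True
    with map_lookup_mono_of[OF assms(1), of "map (Poly_Mapping.lookup p) is"] show ?thesis
      by simp
  next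
    case False
    with assms(2) show ?thesis
      by (auto simp: lookup_mono_of_notin in_keys_iff)
  qed
qed

lemma keys_mono_of: "Poly_Mapping.keys (mono_of is w) \<subseteq> set is"
  using lookup_mono_of_notin by (fastforce simp: in_keys_iff)

lemma shape_list_filter:
  assumes "sorted_wrt (<) ks" "Poly_Mapping.keys p \<subseteq> set ks"
  shows "shape_list p = filter (\<lambda>\<alpha>. \<alpha> \<noteq> 0) (map (Poly_Mapping.lookup p) ks)"
proof -
  let ?ls = "filter (\<lambda>k. Poly_Mapping.lookup p k \<noteq> 0) ks"
  have "set ?ls = Poly_Mapping.keys p"
    using assms(2) by (auto simp: in_keys_iff)
  moreover have "sorted ?ls" "distinct ?ls"
    using sorted_wrt_filter[OF assms(1)] by (auto simp: strict_sorted_iff)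
  ultimately have "sorted_list_of_set (Poly_Mapping.keys p) = ?ls"
    using sorted_list_of_set.idem_if_sorted_distinct[of ?ls] by simp
  then show ?thesis
    by (simp add: shape_list_def filter_map comp_def)
qed

lemma shape_list_nonzero: "0 \<notin> set (shape_list m)"
  by (auto simp: shape_list_def in_keys_iff)

lemma bicomp_list_nonzero: "0 \<notin> set (bicomp_list a)"
  using bicomp_list by blast

lemma shape_list_mono_of:
  assumes "sorted_wrt (<) is" "length is = length w" "0 \<notin> set w"
  shows "shape_list (mono_of is w) = w" "sorted_list_of_set (Poly_Mapping.keys (mono_of is w)) = is"
proof -
  have w: "map (Poly_Mapping.lookup (mono_of is w)) is = w"
    using assms by (intro map_lookup_mono_of) (auto simp: strict_sorted_iff)
  then show "shape_list (mono_of is w) = w"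
    unfolding shape_list_filter[OF assms(1) keys_mono_of] w using assms(3) by (auto intro!: filter_True)
  have "Poly_Mapping.lookup (mono_of is w) ` set is = set w"
    using arg_cong[OF w, of set] by simp
  then have "0 \<notin> Poly_Mapping.lookup (mono_of is w) ` set is"
    using assms(3) by simp
  then have "set is \<subseteq> Poly_Mapping.keys (mono_of is w)"
    by (auto simp: in_keys_iff image_iff)
  then have "Poly_Mapping.keys (mono_of is w) = set is"
    using keys_mono_of by blast
  then show "sorted_list_of_set (Poly_Mapping.keys (mono_of is w)) = is"
    using assms(1) by (simp add: sorted_list_of_set.idem_if_sorted_distinct strict_sorted_iff)
qed

lemma M_series_eq: "M_series a m = of_bool (shape_list m = bicomp_list a)"
proof -
  let ?ks = "sorted_list_of_set (Poly_Mapping.keys m)"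
  have "{is. length is = length (bicomp_list a) \<and> sorted_wrt (<) is \<and> mono_of is (bicomp_list a) = m} =
    (if shape_list m = bicomp_list a then {?ks} else {})"
  proof (cases "shape_list m = bicomp_list a")
    case True
    have "mono_of ?ks (bicomp_list a) = m"
      by (subst True[symmetric], unfold shape_list_def, rule mono_of_map_lookup) auto
    moreover have "length ?ks = length (bicomp_list a)"
      by (metis True shape_list_def length_map)
    ultimately show ?thesis
      using True shape_list_mono_of(2)[OF _ _ bicomp_list_nonzero] by auto
  next
    case False
    then show ?thesis
      using shape_list_mono_of(1)[OF _ _ bicomp_list_nonzero] by auto
  qed
  then show ?thesis
    by (simp add: M_series_def)
qed

definition shape :: "bimonomial \<Rightarrow> bicomp"
  where "shape m = Abs_bicomp (shape_list m)"

lemma bicomp_list_shape: "bicomp_list (shape m) = shape_list m"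
  by (simp add: shape_def Abs_bicomp_inverse shape_list_nonzero)

lemma M_series_shape: "M_series a m = of_bool (shape m = a)"
  by (simp add: M_series_eq bicomp_list_shape[symmetric] bicomp_list_inject)

lemma shape_surj: "\<exists>m. shape m = a"
proof -
  have "shape_list (mono_of [0..<length (bicomp_list a)] (bicomp_list a)) = bicomp_list a"
    by (intro shape_list_mono_of) (auto simp: bicomp_list_nonzero)
  then show ?thesis
    by (metis bicomp_list_shape bicomp_list_inject)
qed

definition splittings :: "(nat \<times> nat) list \<Rightarrow> ((nat \<times> nat) list \<times> (nat \<times> nat) list) set"
  where "splittings w = {(u, v). length u = length w \<and> length v = length w \<and> map2 (+) u v = w}"

definition quasi_shuffle_coeff :: "bicomp \<Rightarrow> bicomp \<Rightarrow> bicomp \<Rightarrow> rat"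
  where "quasi_shuffle_coeff a b c = (\<Sum>(u, v)\<in>splittings (bicomp_list c).
    of_bool (filter (\<lambda>\<alpha>. \<alpha> \<noteq> 0) u = bicomp_list a) * of_bool (filter (\<lambda>\<alpha>. \<alpha> \<noteq> 0) v = bicomp_list b))"

lemma nat_prod_add_eq_0: "x + y = 0 \<longleftrightarrow> x = 0 \<and> y = 0" for x y :: "nat \<times> nat"
  by (cases x; cases y) (auto simp: zero_prod_def)

lemma series_mult_M: "series_mult (M_series a) (M_series b) m = quasi_shuffle_coeff a b (shape m)"
proof -
  define ks where "ks = sorted_list_of_set (Poly_Mapping.keys m)"
  have ks: "sorted_wrt (<) ks" "distinct ks" "set ks = Poly_Mapping.keys m"
    by (simp_all add: ks_def)
  have len: "length (shape_list m) = length ks" and shape: "shape_list m = map (Poly_Mapping.lookup m) ks"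
    by (simp_all add: shape_list_def ks_def)
  have sub: "Poly_Mapping.keys p \<subseteq> set ks" "Poly_Mapping.keys q \<subseteq> set ks" if "p + q = m" for p q
    using that by (auto simp: ks in_keys_iff lookup_add nat_prod_add_eq_0)
  have plus: "map2 (+) (map f ks) (map g ks) = map (\<lambda>k. f k + g k) ks" for f g :: "nat \<Rightarrow> nat \<times> nat"
    by (induction ks) auto
  show ?thesis
    unfolding series_mult_def quasi_shuffle_coeff_def bicomp_list_shape
  proof (rule sum.reindex_bij_witness[where
        j = "\<lambda>(p, q). (map (Poly_Mapping.lookup p) ks, map (Poly_Mapping.lookup q) ks)" and
        i = "\<lambda>(u, v). (mono_of ks u, mono_of ks v)"], goal_cases)
    case (1 x)
    then show ?case
      using sub by (auto simp: mono_of_map_lookup ks(2))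
  next
    case (2 x)
    then show ?case
      by (auto simp: splittings_def shape plus lookup_add)
  next
    case (3 x)
    then show ?case
      by (auto simp: splittings_def len map_lookup_mono_of ks)
  next
    case (4 x)
    obtain u v where x: "x = (u, v)" by (cases x)
    with 4 have uv: "length u = length ks" "length v = length ks" "map2 (+) u v = shape_list m"
      by (auto simp: splittings_def len)
    have "map (\<lambda>k. Poly_Mapping.lookup (mono_of ks u) k + Poly_Mapping.lookup (mono_of ks v) k) ks
        = map (Poly_Mapping.lookup m) ks"
      unfolding plus[symmetric] using uv by (simp add: map_lookup_mono_of ks shape)
    then have "Poly_Mapping.lookup (mono_of ks u + mono_of ks v) k = Poly_Mapping.lookup m k" for k
      by (cases "k \<in> set ks") (auto simp: lookup_add lookup_mono_of_notin, simp add: ks in_keys_iff)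
    then show ?case
      by (simp add: x poly_mapping_eqI)
  next
    case (5 x)
    then show ?case
      using sub by (auto simp: M_series_eq shape_list_filter[OF ks(1)])
  qed
qed

lemma length_splitting:
  "length u = length v \<Longrightarrow> 0 \<notin> set (map2 (+) u v) \<Longrightarrow>
    length u \<le> length (filter (\<lambda>\<alpha>. \<alpha> \<noteq> 0) u) + length (filter (\<lambda>\<alpha>. \<alpha> \<noteq> 0) v)" for u v :: "(nat \<times> nat) list"
  by (induction u v rule: list_induct2) (auto simp: nat_prod_add_eq_0)

lemma finite_quasi_shuffle: "finite {c. quasi_shuffle_coeff a b c \<noteq> 0}"
proof -
  let ?A = "(\<lambda>(x, y). x + y) ` (insert 0 (set (bicomp_list a)) \<times> insert 0 (set (bicomp_list b)))"
  let ?L = "{w. set w \<subseteq> ?A \<and> length w \<le> length (bicomp_list a) + length (bicomp_list b)}"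
  have "bicomp_list c \<in> ?L" if nz: "quasi_shuffle_coeff a b c \<noteq> 0" for c
  proof -
    from nz obtain u v where uv: "(u, v) \<in> splittings (bicomp_list c)"
      "filter (\<lambda>\<alpha>. \<alpha> \<noteq> 0) u = bicomp_list a" "filter (\<lambda>\<alpha>. \<alpha> \<noteq> 0) v = bicomp_list b"
      unfolding quasi_shuffle_coeff_def by (auto elim!: sum.not_neutral_contains_not_neutral)
    then have c: "bicomp_list c = map2 (+) u v" "length u = length v"
      by (auto simp: splittings_def)
    have len: "length u \<le> length (bicomp_list a) + length (bicomp_list b)"
      using length_splitting[OF c(2)] bicomp_list_nonzero[of c] by (simp add: c uv)
    have "set u \<subseteq> insert 0 (set (bicomp_list a))" "set v \<subseteq> insert 0 (set (bicomp_list b))"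
      by (auto simp flip: uv(2,3))
    moreover have "set (map2 (+) u v) \<subseteq> (\<lambda>(x, y). x + y) ` (set u \<times> set v)"
      by (auto dest: set_zip_leftD set_zip_rightD simp del: add_Pair intro!: image_eqI[rotated])
    ultimately have "set (map2 (+) u v) \<subseteq> ?A"
      by (meson Sigma_mono image_mono subset_trans)
    with len show ?thesis
      by (simp add: c)
  qed
  then have "bicomp_list ` {c. quasi_shuffle_coeff a b c \<noteq> 0} \<subseteq> ?L"
    by blast
  moreover have "finite ?L"
    by (intro finite_lists_length_le) auto
  ultimately have "finite (bicomp_list ` {c. quasi_shuffle_coeff a b c \<noteq> 0})"
    by (rule finite_subset)
  then show ?thesis
    by (rule finite_imageD) (simp add: inj_on_def bicomp_list_inject)
qed

lemma fun_sum_apply: "(\<Sum>c\<in>C. f c) x = (\<Sum>c\<in>C. f c x)"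
  by (induction C rule: infinite_finite_induct) auto

lemma series_mult_M_span: "series_mult (M_series a) (M_series b) \<in> Q.span (range M_series)"
proof -
  let ?C = "{c. quasi_shuffle_coeff a b c \<noteq> 0}"
  have "series_mult (M_series a) (M_series b) = (\<Sum>c\<in>?C. quasi_shuffle_coeff a b c *Q M_series c)"
  proof
    fix m
    have "(\<Sum>c\<in>?C. quasi_shuffle_coeff a b c *Q M_series c) m =
        (\<Sum>c\<in>?C. if c = shape m then quasi_shuffle_coeff a b c else 0)"
      by (auto simp: fun_sum_apply scaleQ_fun_def scaleQ_rat_def M_series_shape intro!: sum.cong)
    then show "series_mult (M_series a) (M_series b) m = (\<Sum>c\<in>?C. quasi_shuffle_coeff a b c *Q M_series c) m"
      by (simp add: series_mult_M finite_quasi_shuffle)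
  qed
  then show ?thesis
    by (simp only:) (rule Q.span_sum, rule Q.span_scale, rule Q.span_base, rule rangeI)
qed

lemma bilinear_series_mult: "bilinearQ series_mult"
  unfolding bilinearQ_def
  by (auto intro!: linearQI simp: series_mult_def fun_eq_iff scaleQ_fun_def scaleQ_rat_def
      algebra_simps sum.distrib sum_distrib_left split_def)

lemma bilinearQ_span_closed:
  assumes B: "bilinearQ B" and S: "\<And>x y. x \<in> S \<Longrightarrow> y \<in> T \<Longrightarrow> B x y \<in> U" and U: "Q.subspace U"
    and x: "x \<in> Q.span S" and y: "y \<in> Q.span T"
  shows "B x y \<in> U"
proof -
  have B1: "linearQ (B a)" and B2: "linearQ (\<lambda>a. B a b)" for a b
    using B by (auto simp: bilinearQ_def)
  have *: "B s y \<in> U" if "s \<in> S" for s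
    using y
  proof (induction rule: Q.span_induct)
    case base
    show ?case
      by (auto intro!: Q.subspaceI simp: linearQD[OF B1] Q.subspace_0[OF U] Q.subspace_add[OF U] Q.subspace_scale[OF U])
  qed (use S that in auto)
  show ?thesis
    using x
  proof (induction rule: Q.span_induct)
    case base
    show ?case
      by (auto intro!: Q.subspaceI simp: linearQD[OF B2] Q.subspace_0[OF U] Q.subspace_add[OF U] Q.subspace_scale[OF U])
  qed (use * in auto)
qed

typedef dqsym = "Q.span (range M_series)"
  morphisms dq_series Abs_dqsym
  by (rule exI[of _ 0]) (simp add: Q.span_zero)

setup_lifting type_definition_dqsym

instantiation dqsym :: rat_vector
begin
lift_definition zero_dqsym :: dqsym is 0 by (rule Q.span_zero)
lift_definition plus_dqsym :: "dqsym \<Rightarrow> dqsym \<Rightarrow> dqsym" is "(+)" by (rule Q.span_add)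
lift_definition uminus_dqsym :: "dqsym \<Rightarrow> dqsym" is uminus by (rule Q.span_neg)
lift_definition minus_dqsym :: "dqsym \<Rightarrow> dqsym \<Rightarrow> dqsym" is "(-)" by (rule Q.span_diff)
lift_definition scaleQ_dqsym :: "rat \<Rightarrow> dqsym \<Rightarrow> dqsym" is scaleQ by (rule Q.span_scale)
instance
  by standard (transfer; simp add: algebra_simps scaleQ_add_right scaleQ_add_left scaleQ_scaleQ scaleQ_one)+
end

lift_definition dq_M :: "bicomp \<Rightarrow> dqsym" is M_series
  by (simp add: Q.span_base)

lift_definition dq_mult :: "dqsym \<Rightarrow> dqsym \<Rightarrow> dqsym" is series_mult
  by (rule bilinearQ_span_closed[OF bilinear_series_mult _ Q.subspace_span]) (auto simp: series_mult_M_span)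

definition dq_coords :: "dqsym \<Rightarrow> bicomp \<Rightarrow>\<^sub>0 rat"
  where "dq_coords f = (THE c. lin_ext dq_M c = f)"

lemma linear_dq_series: "linearQ dq_series"
  by (rule linearQI) (transfer, simp)+

lemma dq_series_lin_ext: "dq_series (lin_ext dq_M c) m = Poly_Mapping.lookup c (shape m)"
proof -
  have "dq_series (lin_ext dq_M c) m = (\<Sum>a\<in>Poly_Mapping.keys c. Poly_Mapping.lookup c a * M_series a m)"
    by (simp add: lin_ext_def QQ.linear_sum[OF linear_dq_series] fun_sum_apply scaleQ_dqsym.rep_eq dq_M.rep_eq
        scaleQ_fun_def scaleQ_rat_def)
  also have "\<dots> = (\<Sum>a\<in>Poly_Mapping.keys c. if a = shape m then Poly_Mapping.lookup c a else 0)"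
    by (auto simp: M_series_shape intro!: sum.cong)
  also have "\<dots> = Poly_Mapping.lookup c (shape m)"
    by (auto simp: in_keys_iff)
  finally show ?thesis .
qed

lemma dq_M_basis: "bij (lin_ext dq_M)"
proof (rule bijI)
  show "inj (lin_ext dq_M)"
    by (rule injI, rule poly_mapping_eqI) (metis dq_series_lin_ext shape_surj)
  have "f \<in> dq_series ` range (lin_ext dq_M)" if "f \<in> Q.span (range M_series)" for f
    using that
  proof (induction rule: Q.span_induct)
    case base
    have "Q.subspace (dq_series ` range (lin_ext dq_M))"
      by (intro QQ.linear_subspace_image linear_dq_series linear_lin_ext Q.subspace_UNIV)
    then show ?case by simp
  next
    case (step x)
    then obtain a where "x = M_series a" by blast
    then have "x = dq_series (lin_ext dq_M (Poly_Mapping.single a 1))"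
      by (simp add: scaleQ_one dq_M.rep_eq)
    then show ?case by blast
  qed
  from this[OF dq_series] have "g \<in> range (lin_ext dq_M)" for g
    by (simp add: inj_image_mem_iff inj_def dq_series_inject)
  then show "surj (lin_ext dq_M)" by blast
qed

lemma dq_coords_lin_ext [simp]: "dq_coords (lin_ext dq_M c) = c"
  unfolding dq_coords_def using dq_M_basis by (auto simp: bij_def inj_def)

lemma lin_ext_dq_coords [simp]: "lin_ext dq_M (dq_coords f) = f"
  by (metis dq_coords_lin_ext dq_M_basis bij_pointE)

lemma linear_dq_coords: "linearQ dq_coords"
  by (rule linearQI) (metis dq_coords_lin_ext lin_ext_dq_coords linearQD(1,2)[OF linear_lin_ext])+

lemma dq_coords_M [simp]: "dq_coords (dq_M a) = Poly_Mapping.single a 1"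
  by (metis dq_coords_lin_ext lin_ext_single scaleQ_one)

definition dq_comult :: "dqsym \<Rightarrow> (dqsym, dqsym) tensor"
  where "dq_comult f = lin_ext (\<lambda>a. \<Sum>(a\<^sub>1, a\<^sub>2) | a\<^sub>1 + a\<^sub>2 = a. dq_M a\<^sub>1 \<otimes> dq_M a\<^sub>2) (dq_coords f)"

definition dq_counit :: "dqsym \<Rightarrow> rat"
  where "dq_counit f = lin_ext (\<lambda>a. if a = 0 then 1 else 0) (dq_coords f)"

definition DQSym :: "dqsym bihopf"
  where "DQSym = \<lparr>hmult = dq_mult, hunit = dq_M 0, hcomult = dq_comult, hcounit = dq_counit,
    hcomp = (\<lambda>d. Q.span (dq_M ` {a. bidegree a = d}))\<rparr>"

lemma linear_dq_comult: "linearQ dq_comult"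
  by (rule linearQI) (simp_all add: dq_comult_def linearQD[OF linear_dq_coords] linearQD[OF linear_lin_ext])

lemma linear_dq_counit: "linearQ dq_counit"
  by (rule linearQI) (simp_all add: dq_counit_def linearQD[OF linear_dq_coords] linearQD[OF linear_lin_ext])

text \<open>An element of the direct sum of the duals of the components is a linear functional vanishing on all but
  finitely many components; the summand at \<open>d\<close> consists of those vanishing on all components except the one at \<open>d\<close>.\<close>

definition graded_dual :: "(nat \<times> nat \<Rightarrow> 'a::rat_vector set) \<Rightarrow> ('a \<Rightarrow> rat) set"
  where "graded_dual C = {\<phi>. linearQ \<phi> \<and> finite {d. \<exists>f\<in>C d. \<phi> f \<noteq> 0}}"

lemma subspace_graded_dual: "Q.subspace (graded_dual C)"
proof (rule Q.subspaceI)
  show "0 \<in> graded_dual C"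
    by (auto simp: graded_dual_def scaleQ_rat_def intro!: linearQI)
  fix \<phi> assume \<phi>: "\<phi> \<in> graded_dual C"
  show "r *Q \<phi> \<in> graded_dual C" for r
    using \<phi> by (auto simp: graded_dual_def scaleQ_fun_def scaleQ_rat_def linearQD algebra_simps
        intro!: linearQI elim!: rev_finite_subset)
  fix \<psi> assume \<psi>: "\<psi> \<in> graded_dual C"
  have "finite ({d. \<exists>f\<in>C d. \<phi> f \<noteq> 0} \<union> {d. \<exists>f\<in>C d. \<psi> f \<noteq> 0})"
    using \<phi> \<psi> by (simp add: graded_dual_def)
  moreover have "\<phi> f \<noteq> 0 \<or> \<psi> f \<noteq> 0" if "(\<phi> + \<psi>) f \<noteq> 0" for f
    using that by auto
  ultimately have "finite {d. \<exists>f\<in>C d. (\<phi> + \<psi>) f \<noteq> 0}"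
    by (elim rev_finite_subset) blast
  then show "\<phi> + \<psi> \<in> graded_dual C"
    using \<phi> \<psi> by (auto simp: graded_dual_def linearQD scaleQ_add_right intro!: linearQI)
qed

typedef dqsym_dual = "graded_dual (hcomp DQSym)"
  morphisms dual_eval Abs_dqsym_dual
  by (rule exI, rule Q.subspace_0[OF subspace_graded_dual])

setup_lifting type_definition_dqsym_dual

instantiation dqsym_dual :: rat_vector
begin
lift_definition zero_dqsym_dual :: dqsym_dual is 0
  by (rule Q.subspace_0[OF subspace_graded_dual])
lift_definition plus_dqsym_dual :: "dqsym_dual \<Rightarrow> dqsym_dual \<Rightarrow> dqsym_dual" is "(+)"
  by (rule Q.subspace_add[OF subspace_graded_dual])
lift_definition uminus_dqsym_dual :: "dqsym_dual \<Rightarrow> dqsym_dual" is uminus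
  by (rule Q.subspace_neg[OF subspace_graded_dual])
lift_definition minus_dqsym_dual :: "dqsym_dual \<Rightarrow> dqsym_dual \<Rightarrow> dqsym_dual" is "(-)"
  by (rule Q.subspace_diff[OF subspace_graded_dual])
lift_definition scaleQ_dqsym_dual :: "rat \<Rightarrow> dqsym_dual \<Rightarrow> dqsym_dual" is scaleQ
  by (rule Q.subspace_scale[OF subspace_graded_dual])
instance
  by standard (transfer; simp add: algebra_simps scaleQ_add_right scaleQ_add_left scaleQ_scaleQ scaleQ_one)+
end

lemma bilinear_functional_product:
  "linearQ \<phi> \<Longrightarrow> linearQ \<psi> \<Longrightarrow> bilinearQ (\<lambda>a b. \<phi> a * \<psi> b)" for \<phi> \<psi> :: "dqsym \<Rightarrow> rat"
  by (auto simp: bilinearQ_def linearQD scaleQ_rat_def algebra_simps intro!: linearQI)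

lemma bidegree_add: "bidegree (a + b) = bidegree a + bidegree b"
  unfolding bidegree_def by transfer simp

lift_definition dual_mult :: "dqsym_dual \<Rightarrow> dqsym_dual \<Rightarrow> dqsym_dual"
  is "\<lambda>\<phi> \<psi> f. tensor_lift (\<lambda>a b. \<phi> a * \<psi> b) (hcomult DQSym f)"
  unfolding graded_dual_def
proof safe
  fix \<phi> \<psi> :: "dqsym \<Rightarrow> rat"
  assume lin: "linearQ \<phi>" "linearQ \<psi>"
  let ?D = "\<lambda>\<phi>. {d. \<exists>f\<in>hcomp DQSym d. \<phi> f \<noteq> (0::rat)}"
  let ?\<chi> = "\<lambda>f. tensor_lift (\<lambda>a b. \<phi> a * \<psi> b) (hcomult DQSym f)"
  note bil = bilinear_functional_product[OF lin]
  show lin\<chi>: "linearQ ?\<chi>"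
    by (rule linearQI)
      (simp_all add: DQSym_def linearQD[OF linear_dq_comult] linearQD[OF linear_tensor_lift[OF bil]])
  assume fin: "finite (?D \<phi>)" "finite (?D \<psi>)"
  have "?\<chi> f = 0" if f: "f \<in> hcomp DQSym d" and d: "d \<notin> (\<lambda>(d, e). d + e) ` (?D \<phi> \<times> ?D \<psi>)" for f d
    using f unfolding DQSym_def bihopf.simps
  proof (induction rule: Q.span_induct)
    case base
    show ?case
      using linearQD[OF lin\<chi>] by (auto intro!: Q.subspaceI simp: DQSym_def)
  next
    case (step x)
    then obtain a where a: "x = dq_M a" "bidegree a = d" by blast
    have 0: "\<phi> (dq_M b) * \<psi> (dq_M c) = 0" if "b + c = a" for b c
    proof (rule ccontr)
      assume "\<phi> (dq_M b) * \<psi> (dq_M c) \<noteq> 0"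
      then have nz: "\<phi> (dq_M b) \<noteq> 0" "\<psi> (dq_M c) \<noteq> 0"
        by auto
      have "dq_M e \<in> hcomp DQSym (bidegree e)" for e
        by (simp add: DQSym_def Q.span_base)
      with nz have "bidegree b \<in> ?D \<phi>" "bidegree c \<in> ?D \<psi>"
        by blast+
      then have "bidegree b + bidegree c \<in> (\<lambda>(d, e). d + e) ` (?D \<phi> \<times> ?D \<psi>)"
        by (metis (no_types, lifting) SigmaI case_prod_conv image_eqI)
      with d a(2) that show False
        by (metis bidegree_add)
    qed
    show ?case
      by (auto simp: a dq_comult_def scaleQ_one QQ.linear_sum[OF linear_tensor_lift[OF bil]]
          tensor_lift_pure[OF bil] split_def 0 intro!: sum.neutral simp del: mult_eq_0_iff)
  qed
  then have "?D ?\<chi> \<subseteq> (\<lambda>(d, e). d + e) ` (?D \<phi> \<times> ?D \<psi>)" by blast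
  then show "finite (?D ?\<chi>)"
    by (rule finite_subset) (use fin in auto)
qed

lift_definition dual_unit :: dqsym_dual is "hcounit DQSym"
    unfolding graded_dual_def
proof safe
  show "linearQ (hcounit DQSym)"
    by (simp add: DQSym_def linear_dq_counit)
  have "hcounit DQSym f = 0" if f: "f \<in> hcomp DQSym d" and d: "d \<noteq> 0" for f d
    using f unfolding DQSym_def bihopf.simps
  proof (induction rule: Q.span_induct)
    case base
    show ?case
      by (auto intro!: Q.subspaceI simp: linearQD[OF linear_dq_counit])
  next
    case (step x)
    then show ?case
      using d by (auto simp: dq_counit_def bidegree_def zero_bicomp.rep_eq)
  qed
  then have "{d. \<exists>f\<in>hcomp DQSym d. hcounit DQSym f \<noteq> 0} \<subseteq> {0}" by blast
  then show "finite {d. \<exists>f\<in>hcomp DQSym d. hcounit DQSym f \<noteq> 0}"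
    by (rule finite_subset) simp
qed

text \<open>The transpose of the multiplication.  The element described exists and is unique because the components of
  DQSym are finite-dimensional and its multiplication is bigraded.\<close>

definition dual_comult :: "dqsym_dual \<Rightarrow> (dqsym_dual, dqsym_dual) tensor"
  where "dual_comult \<phi> = (THE t. \<forall>f g.
    tensor_lift (\<lambda>\<psi> \<chi>. dual_eval \<psi> f * dual_eval \<chi> g) t = dual_eval \<phi> (hmult DQSym f g))"

definition dual_counit :: "dqsym_dual \<Rightarrow> rat"
  where "dual_counit \<phi> = dual_eval \<phi> (hunit DQSym)"

definition DQSym_dual :: "dqsym_dual bihopf"
  where "DQSym_dual = \<lparr>hmult = dual_mult, hunit = dual_unit, hcomult = dual_comult, hcounit = dual_counit,
    hcomp = (\<lambda>d. {\<phi>. \<forall>e. e \<noteq> d \<longrightarrow> (\<forall>f\<in>hcomp DQSym e. dual_eval \<phi> f = 0)})\<rparr>"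

end

theory Submission
  imports Defs
begin

text \<open>
  The words in the generators \<open>h\<^sub>\<alpha>\<close> form a basis of DNSym indexed by bicompositions, and so do the series \<open>M\<^sub>a\<close> in
  DQSym.  The isomorphism \<open>dn_dual\<close> sends the word \<open>a\<close> to the functional dual to \<open>M\<^sub>a\<close>.  It is bijective because there are
  only finitely many bicompositions of each bidegree.  It respects products because the coproduct of \<open>M\<^sub>c\<close> runs over the
  factorizations of \<open>c\<close>, while words are multiplied by concatenation (\<open>dn_dual_mult\<close>).

  It respects coproducts because two counts agree (\<open>dn_dual_comult_pairing\<close>).  The coproduct of a word \<open>c\<close> is the sum over
  all ways of splitting each of its letters into two vectors, zero being allowed (\<open>dn_comult_h_word_splittings\<close>); deleting
  the zeros, the coefficient of \<open>a \<otimes> b\<close> in it is the number of splittings of \<open>c\<close> that reduce to \<open>(a, b)\<close>.  The same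
  number, the quasi-shuffle coefficient, is the coefficient of \<open>M\<^sub>c\<close> in \<open>M\<^sub>a M\<^sub>b\<close> (\<open>lookup_dq_coords_mult_M\<close>).  That the
  transpose of the product of DQSym is characterized by its pairings follows from \<open>tensor_eq_by_coefficients\<close>.

  The Hopf algebra axioms are verified for DNSym only (\<open>bigraded_hopf_algebra_DNSym\<close>).  Coassociativity and the
  counit laws hold because both sides are algebra morphisms that agree on generators.  The antipode is the
  antimultiplicative extension of the signed sum over bicompositions \<open>dn_antipode_h\<close>.  The axioms for the dual then follow
  by transport along the isomorphism (\<open>bigraded_hopf_algebra_transport\<close>).
\<close>

section \<open>Linear maps and free vector spaces\<close>

lemma bilinearQI:
  assumes "\<And>x x' y. B (x + x') y = B x y + B x' y" "\<And>r x y. B (r *Q x) y = r *Q B x y"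
    and "\<And>x y y'. B x (y + y') = B x y + B x y'" "\<And>r x y. B x (r *Q y) = r *Q B x y"
  shows "bilinearQ B"
  using assms by (auto simp: bilinearQ_def intro!: linearQI)

lemma bilinearQ_left: "bilinearQ B \<Longrightarrow> linearQ (\<lambda>x. B x y)"
  and bilinearQ_right: "bilinearQ B \<Longrightarrow> linearQ (B x)"
  by (auto simp: bilinearQ_def)

lemmas bilinearQ_simps = linearQD[OF bilinearQ_left] linearQD[OF bilinearQ_right]

lemma linearQ_compose: "linearQ f \<Longrightarrow> linearQ g \<Longrightarrow> linearQ (\<lambda>x. f (g x))"
  by (rule linearQI) (simp_all add: linearQD)

lemma linearQ_id: "linearQ id" and linearQ_ident: "linearQ (\<lambda>x. x)"
  by (rule linearQI; simp)+

lemma linearQ_sum: "linearQ f \<Longrightarrow> f (\<Sum>i\<in>I. g i) = (\<Sum>i\<in>I. f (g i))"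
  by (rule QQ.linear_sum)

lemma bilinearQ_compose:
  assumes "bilinearQ B" "linearQ f" "linearQ g" "linearQ h"
  shows "bilinearQ (\<lambda>x y. h (B (f x) (g y)))"
  by (rule bilinearQI)
    (simp_all add: linearQD[OF assms(2)] linearQD[OF assms(3)] linearQD[OF assms(4)] bilinearQ_simps[OF assms(1)])

lemma lin_ext_basis: "lin_ext (\<lambda>k. Poly_Mapping.single k 1) p = p"
proof (rule poly_mapping_eqI)
  fix k
  have "Poly_Mapping.lookup (lin_ext (\<lambda>k. Poly_Mapping.single k 1) p) k
      = (\<Sum>i\<in>Poly_Mapping.keys p. if i = k then Poly_Mapping.lookup p i else 0)"
    unfolding lin_ext_def lookup_sum
    by (rule sum.cong) (auto simp: lookup_single scaleQ_rat_def when_def)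
  then show "Poly_Mapping.lookup (lin_ext (\<lambda>k. Poly_Mapping.single k 1) p) k = Poly_Mapping.lookup p k"
    by (simp add: in_keys_iff)
qed

lemma linear_eq_on_basis:
  fixes p :: "'k \<Rightarrow>\<^sub>0 rat"
  assumes F: "linearQ F" and G: "linearQ G"
    and eq: "\<And>k. F (Poly_Mapping.single k 1) = G (Poly_Mapping.single k 1)"
  shows "F p = G p"
proof -
  have "H p = (\<Sum>k\<in>Poly_Mapping.keys p. Poly_Mapping.lookup p k *Q H (Poly_Mapping.single k 1))"
    if "linearQ H" for H :: "('k \<Rightarrow>\<^sub>0 rat) \<Rightarrow> 'a"
    by (subst lin_ext_basis[of p, symmetric], unfold lin_ext_def)
      (simp add: linearQ_sum[OF that] linearQD[OF that])
  from this[OF F] this[OF G] show ?thesis by (simp add: eq)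
qed

lemma linearQ_lookup: "linearQ (\<lambda>p. Poly_Mapping.lookup p k)"
  by (rule linearQI) (simp_all add: lookup_add)

lemma span_basis: "Q.span ((\<lambda>k. Poly_Mapping.single k (1::rat)) ` A) = {p. Poly_Mapping.keys p \<subseteq> A}"
proof safe
  fix p k assume "p \<in> Q.span ((\<lambda>k. Poly_Mapping.single k (1::rat)) ` A)" "k \<in> Poly_Mapping.keys p"
  then show "k \<in> A"
  proof (induction arbitrary: rule: Q.span_induct)
    case base
    show ?case
      by (rule Q.subspaceI) (auto simp: in_keys_iff lookup_add)
  qed auto
next
  fix p :: "'a \<Rightarrow>\<^sub>0 rat" assume "Poly_Mapping.keys p \<subseteq> A"
  then have "lin_ext (\<lambda>k. Poly_Mapping.single k 1) p \<in> Q.span ((\<lambda>k. Poly_Mapping.single k (1::rat)) ` A)"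
    unfolding lin_ext_def by (intro Q.span_sum Q.span_scale Q.span_base) auto
  then show "p \<in> Q.span ((\<lambda>k. Poly_Mapping.single k (1::rat)) ` A)"
    by (simp add: lin_ext_basis)
qed

section \<open>Tensor products\<close>

lemma bilinear_tensor_pure: "bilinearQ (\<otimes>)"
proof (rule bilinearQI)
  fix x x' :: 'a and y y' :: 'b and r :: rat
  have eq: "abs_tensor p = abs_tensor q" if "p - q \<in> tensor_relations" for p q :: "'a \<times> 'b \<Rightarrow>\<^sub>0 rat"
    using that by (simp add: tensor.abs_eq_iff)
  show "(x + x') \<otimes> y = x \<otimes> y + x' \<otimes> y"
    unfolding tensor_pure.abs_eq plus_tensor.abs_eq
    by (rule eq, unfold tensor_relations_def diff_diff_eq[symmetric]) (rule Q.span_base, blast)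
  show "x \<otimes> (y + y') = x \<otimes> y + x \<otimes> y'"
    unfolding tensor_pure.abs_eq plus_tensor.abs_eq
    by (rule eq, unfold tensor_relations_def diff_diff_eq[symmetric]) (rule Q.span_base, blast)
  show "(r *Q x) \<otimes> y = r *Q (x \<otimes> y)"
    unfolding tensor_pure.abs_eq scaleQ_tensor.abs_eq
    by (rule eq, unfold tensor_relations_def) (rule Q.span_base, blast)
  show "x \<otimes> (r *Q y) = r *Q (x \<otimes> y)"
    unfolding tensor_pure.abs_eq scaleQ_tensor.abs_eq
    by (rule eq, unfold tensor_relations_def) (rule Q.span_base, blast)
qed

lemmas pure_simps = bilinearQ_simps[OF bilinear_tensor_pure]

lemma linear_abs_tensor: "linearQ abs_tensor"
  by (rule linearQI) (simp_all add: plus_tensor.abs_eq scaleQ_tensor.abs_eq)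

lemma linear_eq_on_pure:
  assumes "linearQ F" "linearQ G" and eq: "\<And>a b. F (a \<otimes> b) = G (a \<otimes> b)"
  shows "F t = G t"
proof -
  obtain p where p: "t = abs_tensor p"
    by (metis Quotient_abs_rep[OF Quotient_tensor])
  have "F (abs_tensor p) = G (abs_tensor p)"
    by (rule linear_eq_on_basis[where F = "\<lambda>p. F (abs_tensor p)"])
      (use eq in \<open>auto intro!: linearQ_compose[OF assms(1) linear_abs_tensor] linearQ_compose[OF assms(2) linear_abs_tensor]
        simp: tensor_pure_def\<close>)
  then show ?thesis by (simp add: p)
qed

text \<open>No case for scalar multiples is needed: a scalar is absorbed into the first factor of a pure tensor.\<close>

lemma tensor_induct [case_names add pure]:
  assumes add: "\<And>s t. P s \<Longrightarrow> P t \<Longrightarrow> P (s + t)" and pure: "\<And>a b. P (a \<otimes> b)"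
  shows "P t"
proof -
  obtain p where p: "t = abs_tensor p"
    by (metis Quotient_abs_rep[OF Quotient_tensor])
  have 0: "P 0"
    using pure[of 0 0] by (simp add: pure_simps)
  have "P (\<Sum>k\<in>K. Poly_Mapping.lookup p k *Q abs_tensor (Poly_Mapping.single k 1))" for K
  proof (induction K rule: infinite_finite_induct)
    case (insert k K)
    have "P (Poly_Mapping.lookup p k *Q abs_tensor (Poly_Mapping.single k 1))"
      using pure[of "Poly_Mapping.lookup p k *Q fst k" "snd k"] by (simp add: tensor_pure_def[symmetric] pure_simps)
         (simp add: tensor_pure_def)
    with insert show ?case by (simp add: add)
  qed (simp_all add: 0)
  moreover have "abs_tensor p = (\<Sum>k\<in>Poly_Mapping.keys p. Poly_Mapping.lookup p k *Q abs_tensor (Poly_Mapping.single k 1))"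
    by (subst lin_ext_basis[of p, symmetric], unfold lin_ext_def)
      (simp add: linearQ_sum[OF linear_abs_tensor] linearQD[OF linear_abs_tensor])
  ultimately show ?thesis by (simp add: p)
qed

text \<open>The linear map out of a tensor product depends linearly on the bilinear map that induces it.  With it,
  bilinearity of \<open>tensor_mult\<close> and of the map underlying \<open>tensor_assoc\<close> reduces to pure tensors, and a sum of
  maps \<open>a \<otimes> b \<mapsto> S a * c\<^sub>i * b\<close> can be collected into the single map with \<open>c = \<Sum> c\<^sub>i\<close>.\<close>

lemma linear_tensor_lift_param:
  assumes B: "\<And>x. bilinearQ (B x)" and L: "\<And>a b. linearQ (\<lambda>x. B x a b)"
  shows "linearQ (\<lambda>x. tensor_lift (B x) t)"
proof (induction t rule: tensor_induct)
  case (add s t)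
  then show ?case
    by (intro linearQI)
      (simp_all add: linearQD[OF linear_tensor_lift[OF B]] linearQD[OF add(1)] linearQD[OF add(2)]
        scaleQ_add_right algebra_simps)
qed (simp add: tensor_lift_pure[OF B] L)

lemma bilinear_pure_map: "linearQ f \<Longrightarrow> linearQ g \<Longrightarrow> bilinearQ (\<lambda>a b. f a \<otimes> g b)"
  by (rule bilinearQI) (simp_all add: linearQD pure_simps)

lemma linear_tensor_map: "linearQ f \<Longrightarrow> linearQ g \<Longrightarrow> linearQ (tensor_map f g)"
  unfolding tensor_map_def by (intro linear_tensor_lift bilinear_pure_map)

lemma tensor_map_pure: "linearQ f \<Longrightarrow> linearQ g \<Longrightarrow> tensor_map f g (a \<otimes> b) = f a \<otimes> g b"
  unfolding tensor_map_def by (simp add: tensor_lift_pure bilinear_pure_map)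

lemma tensor_lift_map:
  assumes "bilinearQ B" "linearQ f" "linearQ g"
  shows "tensor_lift B (tensor_map f g t) = tensor_lift (\<lambda>a b. B (f a) (g b)) t"
proof (rule linear_eq_on_pure[where F = "\<lambda>t. tensor_lift B (tensor_map f g t)"])
  have bil: "bilinearQ (\<lambda>a b. B (f a) (g b))"
    using bilinearQ_compose[OF assms linearQ_id] by simp
  show "linearQ (tensor_lift (\<lambda>a b. B (f a) (g b)))"
    by (rule linear_tensor_lift[OF bil])
  show "tensor_lift B (tensor_map f g (a \<otimes> b)) = tensor_lift (\<lambda>a b. B (f a) (g b)) (a \<otimes> b)" for a b
    by (simp add: tensor_map_pure tensor_lift_pure assms bil)
qed (rule linearQ_compose[OF linear_tensor_lift[OF assms(1)] linear_tensor_map[OF assms(2,3)]])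

lemma linear_tensor_lift_eq:
  assumes "bilinearQ B" "linearQ F"
  shows "F (tensor_lift B t) = tensor_lift (\<lambda>a b. F (B a b)) t"
proof (rule linear_eq_on_pure[where F = "\<lambda>t. F (tensor_lift B t)"])
  have bil: "bilinearQ (\<lambda>a b. F (B a b))"
    using bilinearQ_compose[OF assms(1) linearQ_id linearQ_id assms(2)] by simp
  show "linearQ (tensor_lift (\<lambda>a b. F (B a b)))"
    by (rule linear_tensor_lift[OF bil])
  show "F (tensor_lift B (a \<otimes> b)) = tensor_lift (\<lambda>a b. F (B a b)) (a \<otimes> b)" for a b
    by (simp add: tensor_lift_pure assms bil)
qed (rule linearQ_compose[OF assms(2) linear_tensor_lift[OF assms(1)]])

lemma tensor_map_map:
  assumes "linearQ f" "linearQ g" "linearQ f'" "linearQ g'"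
  shows "tensor_map f g (tensor_map f' g' t) = tensor_map (\<lambda>x. f (f' x)) (\<lambda>x. g (g' x)) t"
  unfolding tensor_map_def[of f g] tensor_map_def[of "\<lambda>x. f (f' x)"]
  by (intro tensor_lift_map bilinear_pure_map assms)

lemma bilinear_assoc_inner: "bilinearQ (\<lambda>a b. a \<otimes> (b \<otimes> c))"
  by (rule bilinearQI) (simp_all add: pure_simps)

lemma bilinear_assoc: "bilinearQ (\<lambda>t c. tensor_lift (\<lambda>a b. a \<otimes> (b \<otimes> c)) t)"
  unfolding bilinearQ_def
  by (intro conjI allI linear_tensor_lift linear_tensor_lift_param bilinear_assoc_inner)
    (auto intro!: linearQI simp: pure_simps)

lemma linear_tensor_assoc: "linearQ tensor_assoc"
  unfolding tensor_assoc_def by (intro linear_tensor_lift bilinear_assoc)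

lemma tensor_assoc_pure: "tensor_assoc ((a \<otimes> b) \<otimes> c) = a \<otimes> (b \<otimes> c)"
  by (simp add: tensor_assoc_def tensor_lift_pure bilinear_assoc bilinear_assoc_inner)

lemma linear_eq_on_pure3:
  assumes F: "linearQ F" and G: "linearQ G" and eq: "\<And>a b c. F ((a \<otimes> b) \<otimes> c) = G ((a \<otimes> b) \<otimes> c)"
  shows "F t = G t"
proof (rule linear_eq_on_pure[OF F G])
  fix s c
  show "F (s \<otimes> c) = G (s \<otimes> c)"
    by (rule linear_eq_on_pure[where F = "\<lambda>s. F (s \<otimes> c)"])
      (rule linearQ_compose[OF F bilinearQ_left[OF bilinear_tensor_pure]]
        linearQ_compose[OF G bilinearQ_left[OF bilinear_tensor_pure]] eq)+
qed

context
  fixes m :: "'a::rat_vector \<Rightarrow> 'a \<Rightarrow> 'a" and n :: "'b::rat_vector \<Rightarrow> 'b \<Rightarrow> 'b"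
  assumes m: "bilinearQ m" and n: "bilinearQ n"
begin

lemma bilinear_tensor_mult_inner: "bilinearQ (\<lambda>c d. m a c \<otimes> n b d)"
  by (intro bilinear_pure_map bilinearQ_right m n)

lemma bilinear_tensor_mult_outer: "bilinearQ (\<lambda>a b. tensor_lift (\<lambda>c d. m a c \<otimes> n b d) t)"
  unfolding bilinearQ_def
  by (intro conjI allI linear_tensor_lift_param bilinear_tensor_mult_inner)
    (auto intro!: linearQI simp: pure_simps bilinearQ_simps[OF m] bilinearQ_simps[OF n])

lemma bilinear_tensor_mult: "bilinearQ (tensor_mult m n)"
  unfolding bilinearQ_def tensor_mult_def
  by (intro conjI allI linear_tensor_lift linear_tensor_lift_param bilinear_tensor_mult_outer bilinear_tensor_mult_inner)

lemma tensor_mult_pure: "tensor_mult m n (a \<otimes> b) (c \<otimes> d) = m a c \<otimes> n b d"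
  by (simp add: tensor_mult_def tensor_lift_pure bilinear_tensor_mult_inner bilinear_pure_map bilinearQ_left m n)

end

lemma bilinear_eq_on_pure:
  assumes F: "bilinearQ F" and G: "bilinearQ G"
    and eq: "\<And>a b c d. F (a \<otimes> b) (c \<otimes> d) = G (a \<otimes> b) (c \<otimes> d)"
  shows "F s t = G s t"
proof (rule linear_eq_on_pure[OF bilinearQ_right[OF F] bilinearQ_right[OF G]])
  show "F s (c \<otimes> d) = G s (c \<otimes> d)" for c d
    by (rule linear_eq_on_pure[OF bilinearQ_left[OF F] bilinearQ_left[OF G]]) (rule eq)
qed

lemma tensor_mult_assoc:
  assumes m: "bilinearQ m" and n: "bilinearQ n"
    and am: "\<And>x y z. m (m x y) z = m x (m y z)" and an: "\<And>x y z. n (n x y) z = n x (n y z)"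
  shows "tensor_mult m n (tensor_mult m n s t) u = tensor_mult m n s (tensor_mult m n t u)"
proof (rule bilinear_eq_on_pure[where F = "\<lambda>s t. tensor_mult m n (tensor_mult m n s t) u"])
  note mn = bilinear_tensor_mult[OF m n]
  show "bilinearQ (\<lambda>s t. tensor_mult m n (tensor_mult m n s t) u)"
    "bilinearQ (\<lambda>s t. tensor_mult m n s (tensor_mult m n t u))"
    by (rule bilinearQI; simp add: bilinearQ_simps[OF mn])+
  show "tensor_mult m n (tensor_mult m n (a \<otimes> b) (c \<otimes> d)) u = tensor_mult m n (a \<otimes> b) (tensor_mult m n (c \<otimes> d) u)"
    for a b c d
    by (rule linear_eq_on_pure[where t = u])
      (auto intro!: bilinearQ_right[OF mn] linearQ_compose[OF bilinearQ_right[OF mn] bilinearQ_right[OF mn]] simp: tensor_mult_pure[OF m n] am an)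
qed

lemma tensor_mult_unit:
  assumes m: "bilinearQ m" and n: "bilinearQ n"
  shows "(\<And>x. m e x = x) \<Longrightarrow> (\<And>x. n e' x = x) \<Longrightarrow> tensor_mult m n (e \<otimes> e') t = t"
    and "(\<And>x. m x e = x) \<Longrightarrow> (\<And>x. n x e' = x) \<Longrightarrow> tensor_mult m n t (e \<otimes> e') = t"
  by (rule linear_eq_on_pure[where t = t and G = "\<lambda>t. t"];
      simp add: bilinearQ_right bilinearQ_left bilinear_tensor_mult m n linearQ_ident tensor_mult_pure)+

lemma tensor_map_mult:
  assumes m: "bilinearQ m" and n: "bilinearQ n" and m': "bilinearQ m'" and n': "bilinearQ n'"
    and f: "linearQ f" and g: "linearQ g"
    and fm: "\<And>x y. f (m x y) = m' (f x) (f y)" and gn: "\<And>x y. g (n x y) = n' (g x) (g y)"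
  shows "tensor_map f g (tensor_mult m n s t) = tensor_mult m' n' (tensor_map f g s) (tensor_map f g t)"
proof (rule bilinear_eq_on_pure[where F = "\<lambda>s t. tensor_map f g (tensor_mult m n s t)"])
  note fg = linear_tensor_map[OF f g]
  show "bilinearQ (\<lambda>s t. tensor_map f g (tensor_mult m n s t))"
    "bilinearQ (\<lambda>s t. tensor_mult m' n' (tensor_map f g s) (tensor_map f g t))"
    using bilinearQ_compose[OF bilinear_tensor_mult[OF m n] linearQ_id linearQ_id fg]
      bilinearQ_compose[OF bilinear_tensor_mult[OF m' n'] fg fg linearQ_id] by simp_all
qed (simp add: tensor_mult_pure m n m' n' tensor_map_pure f g fm gn)

lemma tensor_assoc_mult:
  assumes m: "bilinearQ m" and n: "bilinearQ n" and p: "bilinearQ p"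
  shows "tensor_assoc (tensor_mult (tensor_mult m n) p s t) =
    tensor_mult m (tensor_mult n p) (tensor_assoc s) (tensor_assoc t)"
proof (rule linear_eq_on_pure3[where t = t])
  note bil = bilinear_tensor_mult[OF bilinear_tensor_mult[OF m n] p] bilinear_tensor_mult[OF m bilinear_tensor_mult[OF n p]]
  show "tensor_assoc (tensor_mult (tensor_mult m n) p s ((a \<otimes> b) \<otimes> c)) =
    tensor_mult m (tensor_mult n p) (tensor_assoc s) (tensor_assoc ((a \<otimes> b) \<otimes> c))" for a b c
    by (rule linear_eq_on_pure3[where t = s])
      (auto intro!: linearQ_compose[OF linear_tensor_assoc bilinearQ_left[OF bil(1)]]
        linearQ_compose[OF bilinearQ_left[OF bil(2)] linear_tensor_assoc] simp: tensor_assoc_pure tensor_mult_pure bilinear_tensor_mult m n p)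
  show "linearQ (\<lambda>t. tensor_assoc (tensor_mult (tensor_mult m n) p s t))"
    by (rule linearQ_compose[OF linear_tensor_assoc bilinearQ_right[OF bil(1)]])
  show "linearQ (\<lambda>t. tensor_mult m (tensor_mult n p) (tensor_assoc s) (tensor_assoc t))"
    by (rule linearQ_compose[OF bilinearQ_right[OF bil(2)] linear_tensor_assoc])
qed

section \<open>The algebra of words\<close>

lemma scaleQ_single: "r *Q Poly_Mapping.single k (s::rat) = Poly_Mapping.single k (r * s)"
  by (rule poly_mapping_eqI) (simp add: lookup_single scaleQ_rat_def when_def)

lemma scaleQ_eq_mult:
  fixes x :: "'k::monoid_add \<Rightarrow>\<^sub>0 rat"
  shows "r *Q x = Poly_Mapping.single 0 r * x" "r *Q x = x * Poly_Mapping.single 0 r"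
proof -
  have x: "x = (\<Sum>k\<in>Poly_Mapping.keys x. Poly_Mapping.single k (Poly_Mapping.lookup x k))"
    using lin_ext_basis[of x] by (simp add: lin_ext_def scaleQ_single)
  show "r *Q x = Poly_Mapping.single 0 r * x"
    by (subst (1 2) x) (simp add: sum_distrib_left mult_single Q.scale_sum_right scaleQ_single)
  show "r *Q x = x * Poly_Mapping.single 0 r"
    by (subst (1 2) x) (simp add: sum_distrib_right mult_single Q.scale_sum_right scaleQ_single mult.commute)
qed

lemma bilinear_times: "bilinearQ ((*) :: ('k::monoid_add \<Rightarrow>\<^sub>0 rat) \<Rightarrow> _)"
proof (rule bilinearQI)
  fix r and x y :: "'k \<Rightarrow>\<^sub>0 rat"
  show "r *Q x * y = r *Q (x * y)"
    by (simp add: scaleQ_eq_mult(1) mult.assoc)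
  show "x * r *Q y = r *Q (x * y)"
    by (simp add: scaleQ_eq_mult(2) mult.assoc)
qed (simp_all add: algebra_simps)

lemmas times_simps = bilinearQ_simps[OF bilinear_times]

text \<open>The product of generators along a list of vectors.  The list may contain zero vectors, which contribute the
  factor \<open>1\<close>; they occur when a word is split letter by letter.  Lists without zeros give the basis.\<close>

definition h_word :: "(nat \<times> nat) list \<Rightarrow> dnsym"
  where "h_word w = prod_list (map dn_h w)"

lemma h_word_simps [simp]:
  "h_word [] = 1" "h_word (\<alpha> # w) = dn_h \<alpha> * h_word w" "h_word (v @ w) = h_word v * h_word w"
  by (simp_all add: h_word_def)

lemma dn_h_0 [simp]: "dn_h 0 = 1"
  by (simp add: dn_h_def)

lemma bicomp_add_eq_0 [simp]: "a + b = 0 \<longleftrightarrow> a = 0 \<and> b = 0" for a b :: bicomp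
  by transfer simp

lemma h_word_filter: "h_word w = Poly_Mapping.single (Abs_bicomp (filter (\<lambda>\<alpha>. \<alpha> \<noteq> 0) w)) 1"
proof (induction w)
  case Nil
  then show ?case
    by (simp flip: zero_bicomp_def)
next
  case (Cons \<alpha> w)
  have "Abs_bicomp [\<alpha>] + Abs_bicomp (filter (\<lambda>\<alpha>. \<alpha> \<noteq> 0) w) = Abs_bicomp (\<alpha> # filter (\<lambda>\<alpha>. \<alpha> \<noteq> 0) w)" if "\<alpha> \<noteq> 0"
    using that by (simp add: plus_bicomp.abs_eq eq_onp_def)
  with Cons show ?case
    by (simp add: dn_h_def mult_single)
qed

lemma h_word_bicomp_list: "h_word (bicomp_list a) = Poly_Mapping.single a 1"
proof -
  have "filter (\<lambda>\<alpha>. \<alpha> \<noteq> 0) (bicomp_list a) = bicomp_list a"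
    using bicomp_list_nonzero[of a] by (auto intro!: filter_True)
  then show ?thesis
    by (simp add: h_word_filter bicomp_list_inverse)
qed

lemma dn_word_eq: "dn_word a = Poly_Mapping.single a 1"
  using h_word_bicomp_list by (simp add: dn_word_def h_word_def)

text \<open>Linear maps on DNSym are compared by induction on words, peeling off the first or the last letter.\<close>

lemma dn_linear_eq_Cons:
  assumes "linearQ F" "linearQ G" and one: "F 1 = G 1"
    and step: "\<And>\<alpha> x. \<alpha> \<noteq> 0 \<Longrightarrow> F x = G x \<Longrightarrow> F (dn_h \<alpha> * x) = G (dn_h \<alpha> * x)"
  shows "F x = G (x :: dnsym)"
proof (rule linear_eq_on_basis[OF assms(1,2)])
  have "F (h_word w) = G (h_word w)" if "0 \<notin> set w" for w
    using that by (induction w) (auto intro: one step)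
  from this[OF bicomp_list_nonzero] show "F (Poly_Mapping.single a 1) = G (Poly_Mapping.single a 1)" for a
    by (simp add: h_word_bicomp_list)
qed

lemma dn_linear_eq_snoc:
  assumes "linearQ F" "linearQ G" and one: "F 1 = G 1"
    and step: "\<And>\<alpha> x. \<alpha> \<noteq> 0 \<Longrightarrow> F x = G x \<Longrightarrow> F (x * dn_h \<alpha>) = G (x * dn_h \<alpha>)"
  shows "F x = G (x :: dnsym)"
proof (rule linear_eq_on_basis[OF assms(1,2)])
  have "F (h_word w) = G (h_word w)" if "0 \<notin> set w" for w
    using that by (induction w rule: rev_induct) (auto intro: one step)
  from this[OF bicomp_list_nonzero] show "F (Poly_Mapping.single a 1) = G (Poly_Mapping.single a 1)" for a
    by (simp add: h_word_bicomp_list)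
qed

section \<open>Coproduct and counit of DNSym\<close>

lemma finite_vector_splittings: "finite {(\<beta>, \<gamma>). \<beta> + \<gamma> = (\<alpha> :: nat \<times> nat)}"
proof (rule finite_subset)
  show "{(\<beta>, \<gamma>). \<beta> + \<gamma> = \<alpha>} \<subseteq> ({..fst \<alpha>} \<times> {..snd \<alpha>}) \<times> ({..fst \<alpha>} \<times> {..snd \<alpha>})"
    by auto
qed simp

abbreviation dn_tensor_mult :: "(dnsym, dnsym) tensor \<Rightarrow> (dnsym, dnsym) tensor \<Rightarrow> (dnsym, dnsym) tensor" (infixl "\<bullet>" 70)
  where "s \<bullet> t \<equiv> tensor_mult (*) (*) s t"

lemmas bilinear_dn_tensor_mult = bilinear_tensor_mult[OF bilinear_times bilinear_times]
lemmas dn_tensor_mult_pure = tensor_mult_pure[OF bilinear_times bilinear_times]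
lemmas dn_tensor_mult_assoc = tensor_mult_assoc[OF bilinear_times bilinear_times mult.assoc mult.assoc]
lemmas dn_tensor_mult_unit =
  tensor_mult_unit(1)[OF bilinear_times bilinear_times mult_1_left mult_1_left]
  tensor_mult_unit(2)[OF bilinear_times bilinear_times mult_1_right mult_1_right]

lemma linear_dn_comult: "linearQ dn_comult"
  unfolding dn_comult_def by (rule linear_lin_ext)

lemma dn_comult_1: "dn_comult 1 = 1 \<otimes> 1"
  by (simp add: dn_comult_def scaleQ_one zero_bicomp.rep_eq flip: single_one)

lemma foldr_tensor_mult_append:
  "foldr (\<bullet>) (ss @ ts) (1 \<otimes> 1) = foldr (\<bullet>) ss (1 \<otimes> 1) \<bullet> foldr (\<bullet>) ts (1 \<otimes> 1)"
  by (induction ss) (simp_all add: dn_tensor_mult_unit dn_tensor_mult_assoc)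

lemma dn_comult_mult: "dn_comult (x * y) = dn_comult x \<bullet> dn_comult y"
proof (rule linear_eq_on_basis[where p = x])
  show "linearQ (\<lambda>x. dn_comult (x * y))" "linearQ (\<lambda>x. dn_comult x \<bullet> dn_comult y)"
    by (rule linearQI; simp add: linearQD[OF linear_dn_comult] times_simps bilinearQ_simps[OF bilinear_dn_tensor_mult])+
  show "dn_comult (Poly_Mapping.single a 1 * y) = dn_comult (Poly_Mapping.single a 1) \<bullet> dn_comult y" for a
  proof (rule linear_eq_on_basis[where p = y])
    show "linearQ (\<lambda>y. dn_comult (Poly_Mapping.single a 1 * y))"
      "linearQ (\<lambda>y. dn_comult (Poly_Mapping.single a 1) \<bullet> dn_comult y)"
      by (rule linearQI; simp add: linearQD[OF linear_dn_comult] times_simps bilinearQ_simps[OF bilinear_dn_tensor_mult])+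
    show "dn_comult (Poly_Mapping.single a 1 * Poly_Mapping.single b 1) =
        dn_comult (Poly_Mapping.single a 1) \<bullet> dn_comult (Poly_Mapping.single b 1)" for b
      by (simp add: mult_single dn_comult_def scaleQ_one plus_bicomp.rep_eq foldr_tensor_mult_append del: foldr_append)
  qed
qed

lemma dn_comult_h_0: "dn_comult_h 0 = 1 \<otimes> 1"
proof -
  have "{(\<beta>, \<gamma>). \<beta> + \<gamma> = (0 :: nat \<times> nat)} = {(0, 0)}"
    by (auto simp: nat_prod_add_eq_0)
  then show ?thesis
    by (simp add: dn_comult_h_def)
qed

lemma dn_comult_dn_h: "dn_comult (dn_h \<alpha>) = dn_comult_h \<alpha>"
  by (auto simp: dn_h_def dn_comult_1 dn_comult_h_0)
    (simp add: dn_comult_def scaleQ_one Abs_bicomp_inverse dn_tensor_mult_unit)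

text \<open>The counit reads off the constant term.\<close>

lemma dn_counit_eq: "dn_counit x = Poly_Mapping.lookup x 0"
proof (rule linear_eq_on_basis[where p = x])
  show "dn_counit (Poly_Mapping.single a 1) = Poly_Mapping.lookup (Poly_Mapping.single a 1) 0" for a
  proof (cases "bicomp_list a")
    case Nil
    then have "a = 0"
      by (metis bicomp_list_inject zero_bicomp.rep_eq)
    then show ?thesis
      by (simp add: dn_counit_def scaleQ_rat_def zero_bicomp.rep_eq flip: single_one)
  next
    case (Cons \<alpha> w)
    then have "a \<noteq> 0" "\<alpha> \<noteq> 0"
      using bicomp_list_nonzero[of a] by (auto simp: zero_bicomp.rep_eq)
    then show ?thesis
      by (simp add: dn_counit_def scaleQ_rat_def lookup_single Cons)
  qed
qed (simp_all add: dn_counit_def linear_lin_ext linearQ_lookup)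

lemma linear_dn_counit: "linearQ dn_counit"
  unfolding dn_counit_def by (rule linear_lin_ext)

lemma dn_counit_mult: "dn_counit (x * y) = dn_counit x * dn_counit y"
proof (rule linear_eq_on_basis[where p = x])
  show "linearQ (\<lambda>x. dn_counit (x * y))" "linearQ (\<lambda>x. dn_counit x * dn_counit y)"
    by (rule linearQI; simp add: linearQD[OF linear_dn_counit] times_simps algebra_simps scaleQ_rat_def)+
  show "dn_counit (Poly_Mapping.single a 1 * y) = dn_counit (Poly_Mapping.single a 1) * dn_counit y" for a
  proof (rule linear_eq_on_basis[where p = y])
    show "linearQ (\<lambda>y. dn_counit (Poly_Mapping.single a 1 * y))"
      "linearQ (\<lambda>y. dn_counit (Poly_Mapping.single a 1) * dn_counit y)"
      by (rule linearQI; simp add: linearQD[OF linear_dn_counit] times_simps algebra_simps scaleQ_rat_def)+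
  qed (simp add: dn_counit_eq mult_single lookup_single when_def)
qed

lemma dn_counit_h: "dn_counit (dn_h \<alpha>) = of_bool (\<alpha> = 0)"
proof -
  have "Abs_bicomp [\<alpha>] \<noteq> 0" if "\<alpha> \<noteq> 0"
    using that by (metis Abs_bicomp_inverse list.discI list.set(1,2) empty_iff insert_iff mem_Collect_eq zero_bicomp.rep_eq)
  then show ?thesis
    by (auto simp: dn_counit_eq dn_h_def lookup_single)
qed

text \<open>Both sides are algebra morphisms into the threefold tensor product; on a generator \<open>h\<^sub>\<alpha>\<close> both are the sum of
  \<open>h\<^sub>\<beta> \<otimes> (h\<^sub>\<gamma> \<otimes> h\<^sub>\<delta>)\<close> over \<open>\<beta> + \<gamma> + \<delta> = \<alpha>\<close>.\<close>

lemma dn_coassoc: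
  "tensor_assoc (tensor_map dn_comult id (dn_comult x)) = tensor_map id dn_comult (dn_comult x)"
  (is "?F x = ?G x")
proof -
  let ?M = "tensor_mult (*) (\<bullet>)"
  note lin_left = linear_tensor_map[OF linear_dn_comult linearQ_id]
  note lin_right = linear_tensor_map[OF linearQ_id linear_dn_comult]
  have linF: "linearQ ?F"
    by (rule linearQ_compose[OF linear_tensor_assoc linearQ_compose[OF lin_left linear_dn_comult]])
  have linG: "linearQ ?G"
    by (rule linearQ_compose[OF lin_right linear_dn_comult])
  have id_mult: "id (x * y) = id x * id y" for x y :: dnsym
    by simp
  have mult: "?F (x * y) = ?M (?F x) (?F y)" "?G (x * y) = ?M (?G x) (?G y)" for x y
  proof -
    have "tensor_map dn_comult id (s \<bullet> t) =
        tensor_mult (\<bullet>) (*) (tensor_map dn_comult id s) (tensor_map dn_comult id t)" for s t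
      by (rule tensor_map_mult)
        (rule bilinear_times bilinear_dn_tensor_mult linear_dn_comult linearQ_id dn_comult_mult id_mult)+
    then show "?F (x * y) = ?M (?F x) (?F y)"
      using tensor_assoc_mult[OF bilinear_times bilinear_times bilinear_times] by (simp only: dn_comult_mult)
    have "tensor_map id dn_comult (s \<bullet> t) =
        tensor_mult (*) (\<bullet>) (tensor_map id dn_comult s) (tensor_map id dn_comult t)" for s t
      by (rule tensor_map_mult)
        (rule bilinear_times bilinear_dn_tensor_mult linear_dn_comult linearQ_id dn_comult_mult id_mult)+
    then show "?G (x * y) = ?M (?G x) (?G y)"
      by (simp only: dn_comult_mult)
  qed
  show ?thesis
  proof (rule dn_linear_eq_Cons[OF linF linG])
    show "?F 1 = ?G 1"
      by (simp add: dn_comult_1 tensor_map_pure linear_dn_comult linearQ_id linearQ_ident tensor_assoc_pure)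
    fix \<alpha> x assume IH: "?F x = ?G x"
    let ?V = "\<lambda>\<alpha>. {(\<beta>, \<gamma>). \<beta> + \<gamma> = (\<alpha> :: nat \<times> nat)}"
    have "?F (dn_h \<alpha>) = (\<Sum>(\<beta>, \<gamma>)\<in>?V \<alpha>. \<Sum>(\<mu>, \<nu>)\<in>?V \<beta>. dn_h \<mu> \<otimes> (dn_h \<nu> \<otimes> dn_h \<gamma>))"
      by (simp add: dn_comult_dn_h dn_comult_h_def linearQ_sum[OF lin_left[unfolded id_def]] linearQ_sum[OF linear_tensor_assoc]
          tensor_map_pure linear_dn_comult linearQ_id linearQ_ident split_def linearQ_sum[OF bilinearQ_left[OF bilinear_tensor_pure]]
          tensor_assoc_pure)
    also have "\<dots> = (\<Sum>((\<beta>, \<gamma>), \<mu>, \<nu>)\<in>Sigma (?V \<alpha>) (\<lambda>(\<beta>, \<gamma>). ?V \<beta>). dn_h \<mu> \<otimes> (dn_h \<nu> \<otimes> dn_h \<gamma>))"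
      by (subst sum.Sigma[symmetric]) (simp_all add: finite_vector_splittings[unfolded split_def] split_def)
    also have "\<dots> = (\<Sum>((\<beta>, \<gamma>), \<mu>, \<nu>)\<in>Sigma (?V \<alpha>) (\<lambda>(\<beta>, \<gamma>). ?V \<gamma>). dn_h \<beta> \<otimes> (dn_h \<mu> \<otimes> dn_h \<nu>))"
      by (rule sum.reindex_bij_witness[where
            j = "\<lambda>((\<beta>, \<gamma>), \<mu>, \<nu>). ((\<mu>, \<nu> + \<gamma>), \<nu>, \<gamma>)" and i = "\<lambda>((\<beta>, \<gamma>), \<mu>, \<nu>). ((\<beta> + \<mu>, \<nu>), \<beta>, \<mu>)"])
        (auto simp: algebra_simps)
    also have "\<dots> = (\<Sum>(\<beta>, \<gamma>)\<in>?V \<alpha>. \<Sum>(\<mu>, \<nu>)\<in>?V \<gamma>. dn_h \<beta> \<otimes> (dn_h \<mu> \<otimes> dn_h \<nu>))"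
      by (subst sum.Sigma[symmetric]) (simp_all add: finite_vector_splittings[unfolded split_def] split_def)
    also have "\<dots> = ?G (dn_h \<alpha>)"
      by (simp add: dn_comult_dn_h dn_comult_h_def linearQ_sum[OF lin_right[unfolded id_def]]
          tensor_map_pure linear_dn_comult linearQ_id linearQ_ident split_def linearQ_sum[OF bilinearQ_right[OF bilinear_tensor_pure]])
    finally show "?F (dn_h \<alpha> * x) = ?G (dn_h \<alpha> * x)"
      by (simp only: mult IH)
  qed
qed

lemma dn_counit_left: "tensor_lift (\<lambda>a b. dn_counit a *Q b) (dn_comult x) = x"
  and dn_counit_right: "tensor_lift (\<lambda>a b. dn_counit b *Q a) (dn_comult x) = x"
proof -
  let ?L = "tensor_lift (\<lambda>a b. dn_counit a *Q b)" and ?R = "tensor_lift (\<lambda>a b. dn_counit b *Q a)"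
  have bil: "bilinearQ (\<lambda>a b. dn_counit a *Q b)" "bilinearQ (\<lambda>a b. dn_counit b *Q a)"
    by (rule bilinearQI; simp add: linearQD[OF linear_dn_counit] scaleQ_add_left scaleQ_add_right scaleQ_scaleQ
        scaleQ_rat_def mult.commute)+
  note lin = bil[THEN linear_tensor_lift]
  note dn_prod = bilinear_dn_tensor_mult bilinear_times
  have L: "?L (s \<bullet> t) = ?L s * ?L t" for s t
    by (rule bilinear_eq_on_pure[where s = s and t = t])
      (use bilinearQ_compose[OF dn_prod(1) linearQ_id linearQ_id lin(1)]
        bilinearQ_compose[OF dn_prod(2) lin(1) lin(1) linearQ_id] in
        \<open>simp_all add: tensor_lift_pure bil dn_tensor_mult_pure dn_counit_mult times_simps scaleQ_scaleQ mult.commute\<close>)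
  have R: "?R (s \<bullet> t) = ?R s * ?R t" for s t
    by (rule bilinear_eq_on_pure[where s = s and t = t])
      (use bilinearQ_compose[OF dn_prod(1) linearQ_id linearQ_id lin(2)]
        bilinearQ_compose[OF dn_prod(2) lin(2) lin(2) linearQ_id] in
        \<open>simp_all add: tensor_lift_pure bil dn_tensor_mult_pure dn_counit_mult times_simps scaleQ_scaleQ mult.commute\<close>)
  let ?V = "\<lambda>\<alpha>. {(\<beta>, \<gamma>). \<beta> + \<gamma> = (\<alpha> :: nat \<times> nat)}"
  have Lh: "?L (dn_comult_h \<alpha>) = dn_h \<alpha>" for \<alpha>
  proof -
    have "?L (dn_comult_h \<alpha>) = (\<Sum>(\<beta>, \<gamma>)\<in>?V \<alpha>. of_bool (\<beta> = 0) *Q dn_h \<gamma>)"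
      by (simp add: dn_comult_h_def linearQ_sum[OF lin(1)] split_def tensor_lift_pure bil dn_counit_h)
    also have "\<dots> = (\<Sum>(\<beta>, \<gamma>)\<in>{(0 :: nat \<times> nat, \<alpha>)}. of_bool (\<beta> = 0) *Q dn_h \<gamma>)"
      by (rule sum.mono_neutral_right) (auto simp: finite_vector_splittings)
    finally show ?thesis by (simp add: scaleQ_one)
  qed
  have Rh: "?R (dn_comult_h \<alpha>) = dn_h \<alpha>" for \<alpha>
  proof -
    have "?R (dn_comult_h \<alpha>) = (\<Sum>(\<beta>, \<gamma>)\<in>?V \<alpha>. of_bool (\<gamma> = 0) *Q dn_h \<beta>)"
      by (simp add: dn_comult_h_def linearQ_sum[OF lin(2)] split_def tensor_lift_pure bil dn_counit_h)
    also have "\<dots> = (\<Sum>(\<beta>, \<gamma>)\<in>{(\<alpha>, 0 :: nat \<times> nat)}. of_bool (\<gamma> = 0) *Q dn_h \<beta>)"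
      by (rule sum.mono_neutral_right) (auto simp: finite_vector_splittings)
    finally show ?thesis by (simp add: scaleQ_one)
  qed
  have one: "dn_counit 1 = 1"
    by (simp add: dn_counit_eq)
  show "?L (dn_comult x) = x"
    by (rule dn_linear_eq_Cons[where F = "\<lambda>x. ?L (dn_comult x)" and G = "\<lambda>x. x"])
      (simp_all add: linearQ_compose[OF lin(1) linear_dn_comult] linearQ_ident dn_comult_1
        tensor_lift_pure bil one scaleQ_one dn_comult_mult dn_comult_dn_h L Lh)
  show "?R (dn_comult x) = x"
    by (rule dn_linear_eq_Cons[where F = "\<lambda>x. ?R (dn_comult x)" and G = "\<lambda>x. x"])
      (simp_all add: linearQ_compose[OF lin(2) linear_dn_comult] linearQ_ident dn_comult_1
        tensor_lift_pure bil one scaleQ_one dn_comult_mult dn_comult_dn_h R Rh)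
qed

section \<open>The bigrading of DNSym\<close>

text \<open>The component of bidegree \<open>d\<close>, described by supports; \<open>span_dn_word\<close> identifies it with the span of words.\<close>

definition dn_comp :: "nat \<times> nat \<Rightarrow> dnsym set"
  where "dn_comp d = {x. Poly_Mapping.keys x \<subseteq> {a. bidegree a = d}}"

lemma span_dn_word: "Q.span (dn_word ` {a. bidegree a = d}) = dn_comp d"
proof -
  have "dn_word ` A = (\<lambda>a. Poly_Mapping.single a 1) ` A" for A
    by (rule image_cong) (simp_all add: dn_word_eq)
  then show ?thesis
    by (simp only: dn_comp_def span_basis)
qed

lemma mem_dn_comp_iff: "x \<in> dn_comp d \<longleftrightarrow> (\<forall>a. bidegree a \<noteq> d \<longrightarrow> Poly_Mapping.lookup x a = 0)"
  by (auto simp: dn_comp_def in_keys_iff)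

lemma subspace_dn_comp: "Q.subspace (dn_comp d)"
  unfolding span_dn_word[symmetric] by (rule Q.subspace_span)

lemma dn_comp_induct [consumes 1, case_names linear word]:
  assumes x: "x \<in> dn_comp d" and lin: "linearQ F" and U: "Q.subspace U"
    and word: "\<And>w. 0 \<notin> set w \<Longrightarrow> sum_list w = d \<Longrightarrow> F (h_word w) \<in> U"
  shows "F x \<in> U"
  using x unfolding span_dn_word[symmetric]
proof (induction rule: Q.span_induct)
  case base
  show ?case
    by (rule Q.subspaceI) (simp_all add: linearQD[OF lin] Q.subspace_0[OF U] Q.subspace_add[OF U] Q.subspace_scale[OF U])
next
  case (step x)
  then obtain a where "x = h_word (bicomp_list a)" "sum_list (bicomp_list a) = d"
    by (auto simp: h_word_bicomp_list dn_word_eq bidegree_def)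
  then show ?case
    by (simp add: word bicomp_list_nonzero)
qed

lemma dn_comp_mult:
  assumes "x \<in> dn_comp d" "y \<in> dn_comp e" shows "x * y \<in> dn_comp (d + e)"
proof -
  have "bidegree c = d + e" if "c \<in> Poly_Mapping.keys (x * y)" for c
  proof -
    obtain a b where "c = a + b" "a \<in> Poly_Mapping.keys x" "b \<in> Poly_Mapping.keys y"
      using \<open>c \<in> Poly_Mapping.keys (x * y)\<close> keys_mult[of x y] by blast
    then show ?thesis
      using assms by (auto simp: dn_comp_def bidegree_add)
  qed
  then show ?thesis
    by (auto simp: dn_comp_def)
qed

lemma dn_comp_1: "1 \<in> dn_comp 0"
  by (auto simp: dn_comp_def bidegree_def zero_bicomp.rep_eq)

lemma dn_comp_dn_h: "dn_h \<alpha> \<in> dn_comp \<alpha>"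
  by (cases "\<alpha> = 0") (auto simp: zero_bicomp.rep_eq dn_h_def dn_comp_def bidegree_def Abs_bicomp_inverse)

lemma dn_comp_prod_list:
  "(\<And>\<alpha>. f \<alpha> \<in> dn_comp \<alpha>) \<Longrightarrow> prod_list (map f w) \<in> dn_comp (sum_list w)"
  by (induction w) (auto intro: dn_comp_1 dn_comp_mult)

lemma dn_comp_h_word: "h_word w \<in> dn_comp (sum_list w)"
  unfolding h_word_def by (intro dn_comp_prod_list dn_comp_dn_h)

text \<open>The summand of \<open>x\<close> in degree \<open>d\<close> is the restriction of \<open>x\<close> to the words of bidegree \<open>d\<close>.\<close>

lemma dn_comp_direct_sum:
  "\<exists>!c :: nat \<times> nat \<Rightarrow>\<^sub>0 dnsym. (\<forall>d. Poly_Mapping.lookup c d \<in> dn_comp d) \<and>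
    x = (\<Sum>d\<in>Poly_Mapping.keys c. Poly_Mapping.lookup c d)"
proof (rule ex_ex1I)
  define c where "c = (\<Sum>a\<in>Poly_Mapping.keys x. Poly_Mapping.single (bidegree a)
    (Poly_Mapping.single a (Poly_Mapping.lookup x a)))"
  have c: "Poly_Mapping.lookup (Poly_Mapping.lookup c d) b = (if bidegree b = d then Poly_Mapping.lookup x b else 0)" for d b
  proof -
    have "Poly_Mapping.lookup (Poly_Mapping.lookup c d) b =
        (\<Sum>a\<in>Poly_Mapping.keys x. if a = b then (if bidegree b = d then Poly_Mapping.lookup x b else 0) else 0)"
      unfolding c_def lookup_sum by (rule sum.cong) (auto simp: lookup_single when_def)
    then show ?thesis
      by (simp add: in_keys_iff)
  qed
  have "x = (\<Sum>d\<in>Poly_Mapping.keys c. Poly_Mapping.lookup c d)"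
  proof (rule poly_mapping_eqI)
    fix b
    have "bidegree b \<in> Poly_Mapping.keys c" if "Poly_Mapping.lookup x b \<noteq> 0"
      using that c[of "bidegree b" b] by (auto simp: in_keys_iff)
    then show "Poly_Mapping.lookup x b = Poly_Mapping.lookup (\<Sum>d\<in>Poly_Mapping.keys c. Poly_Mapping.lookup c d) b"
      by (auto simp: lookup_sum c)
  qed
  then show "\<exists>c. (\<forall>d. Poly_Mapping.lookup c d \<in> dn_comp d) \<and> x = (\<Sum>d\<in>Poly_Mapping.keys c. Poly_Mapping.lookup c d)"
    by (intro exI[of _ c]) (simp add: mem_dn_comp_iff c)
next
  have coeff: "Poly_Mapping.lookup (Poly_Mapping.lookup c d) b = (if bidegree b = d then Poly_Mapping.lookup x b else 0)"
    if c: "\<forall>d. Poly_Mapping.lookup c d \<in> dn_comp d" "x = (\<Sum>d\<in>Poly_Mapping.keys c. Poly_Mapping.lookup c d)"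
    for c :: "nat \<times> nat \<Rightarrow>\<^sub>0 dnsym" and d b
  proof (cases "bidegree b = d")
    case True
    have "Poly_Mapping.lookup x b =
        (\<Sum>e\<in>Poly_Mapping.keys c. if e = d then Poly_Mapping.lookup (Poly_Mapping.lookup c d) b else 0)"
      unfolding c(2) lookup_sum by (rule sum.cong) (use c(1) True in \<open>auto simp: mem_dn_comp_iff\<close>)
    also have "\<dots> = Poly_Mapping.lookup (Poly_Mapping.lookup c d) b"
      by (simp add: in_keys_iff)
    finally show ?thesis
      using True by simp
  next
    case False
    have "Poly_Mapping.lookup c d \<in> dn_comp d"
      using c(1) by blast
    with False show ?thesis
      by (simp add: mem_dn_comp_iff)
  qed
  fix c c' :: "nat \<times> nat \<Rightarrow>\<^sub>0 dnsym"
  assume "(\<forall>d. Poly_Mapping.lookup c d \<in> dn_comp d) \<and> x = (\<Sum>d\<in>Poly_Mapping.keys c. Poly_Mapping.lookup c d)"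
    "(\<forall>d. Poly_Mapping.lookup c' d \<in> dn_comp d) \<and> x = (\<Sum>d\<in>Poly_Mapping.keys c'. Poly_Mapping.lookup c' d)"
  then show "c = c'"
    by (intro poly_mapping_eqI) (simp add: coeff)
qed

text \<open>The component of bidegree \<open>d\<close> of the tensor square.\<close>

definition dn_tensor_comp :: "nat \<times> nat \<Rightarrow> (dnsym, dnsym) tensor set"
  where "dn_tensor_comp d = Q.span {a \<otimes> b |a b. \<exists>e f. e + f = d \<and> a \<in> dn_comp e \<and> b \<in> dn_comp f}"

lemma subspace_dn_tensor_comp: "Q.subspace (dn_tensor_comp d)"
  unfolding dn_tensor_comp_def by (rule Q.subspace_span)

lemma dn_tensor_comp_pure: "a \<in> dn_comp e \<Longrightarrow> b \<in> dn_comp f \<Longrightarrow> a \<otimes> b \<in> dn_tensor_comp (e + f)"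
  unfolding dn_tensor_comp_def by (rule Q.span_base) blast

lemma dn_tensor_comp_mult:
  assumes "s \<in> dn_tensor_comp d" "t \<in> dn_tensor_comp e" shows "s \<bullet> t \<in> dn_tensor_comp (d + e)"
proof (rule bilinearQ_span_closed[OF bilinear_dn_tensor_mult _ subspace_dn_tensor_comp assms[unfolded dn_tensor_comp_def]])
  fix s t
  assume "s \<in> {a \<otimes> b |a b. \<exists>e f. e + f = d \<and> a \<in> dn_comp e \<and> b \<in> dn_comp f}"
    "t \<in> {a \<otimes> b |a b. \<exists>e' f. e' + f = e \<and> a \<in> dn_comp e' \<and> b \<in> dn_comp f}"
  then obtain a b a' b' i j i' j' where st: "s = a \<otimes> b" "t = a' \<otimes> b'" and d: "d = i + j" "e = i' + j'"
    and mem: "a \<in> dn_comp i" "b \<in> dn_comp j" "a' \<in> dn_comp i'" "b' \<in> dn_comp j'"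
    by blast
  have "(a * a') \<otimes> (b * b') \<in> dn_tensor_comp ((i + i') + (j + j'))"
    by (intro dn_tensor_comp_pure dn_comp_mult mem)
  moreover have "(i + i') + (j + j') = d + e"
    by (simp add: d algebra_simps)
  ultimately show "s \<bullet> t \<in> dn_tensor_comp (d + e)"
    by (simp add: st dn_tensor_mult_pure)
qed

lemma dn_tensor_comp_dn_comult_h_word: "dn_comult (h_word w) \<in> dn_tensor_comp (sum_list w)"
proof (induction w)
  case Nil
  show ?case
    using dn_tensor_comp_pure[OF dn_comp_1 dn_comp_1] by (simp add: dn_comult_1)
next
  case (Cons \<alpha> w)
  have "dn_h \<beta> \<otimes> dn_h \<gamma> \<in> dn_tensor_comp \<alpha>" if "\<beta> + \<gamma> = \<alpha>" for \<beta> \<gamma>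
    using dn_tensor_comp_pure[OF dn_comp_dn_h dn_comp_dn_h, of \<beta> \<gamma>] that by simp
  then have "dn_comult_h \<alpha> \<in> dn_tensor_comp \<alpha>"
    unfolding dn_comult_h_def by (intro Q.subspace_sum[OF subspace_dn_tensor_comp]) (simp add: split_def)
  with Cons show ?case
    by (simp add: dn_comult_mult dn_comult_dn_h dn_tensor_comp_mult)
qed

lemma dn_comp_comult: "x \<in> dn_comp d \<Longrightarrow> dn_comult x \<in> dn_tensor_comp d"
  by (erule dn_comp_induct[OF _ linear_dn_comult subspace_dn_tensor_comp]) (metis dn_tensor_comp_dn_comult_h_word)

section \<open>The antipode of DNSym\<close>

text \<open>The bicompositions of bidegree \<open>\<alpha>\<close>, as lists.\<close>

definition compositions :: "nat \<times> nat \<Rightarrow> (nat \<times> nat) list set"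
  where "compositions \<alpha> = {w. 0 \<notin> set w \<and> sum_list w = \<alpha>}"

lemma length_le_sum_list: "0 \<notin> set w \<Longrightarrow> length w \<le> fst (sum_list w) + snd (sum_list w)" for w :: "(nat \<times> nat) list"
  by (induction w) (auto simp: zero_prod_def)

lemma finite_compositions: "finite (compositions \<alpha>)"
proof (rule finite_subset)
  show "compositions \<alpha> \<subseteq> {w. set w \<subseteq> {..fst \<alpha>} \<times> {..snd \<alpha>} \<and> length w \<le> fst \<alpha> + snd \<alpha>}"
  proof
    fix w assume w: "w \<in> compositions \<alpha>"
    have "\<gamma> \<in> set w \<Longrightarrow> fst \<gamma> \<le> fst (sum_list w) \<and> snd \<gamma> \<le> snd (sum_list w)" for \<gamma>
      by (induction w) auto
    with w length_le_sum_list[of w] show "w \<in> {w. set w \<subseteq> {..fst \<alpha>} \<times> {..snd \<alpha>} \<and> length w \<le> fst \<alpha> + snd \<alpha>}"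
      by (force simp: compositions_def)
  qed
qed (auto intro: finite_lists_length_le)

text \<open>The antipode on generators, \<open>S(h\<^sub>\<alpha>) = \<Sum> (-1)\<^sup>k h_word (\<alpha>\<^sub>1, \<dots>, \<alpha>\<^sub>k)\<close> over all bicompositions of \<open>\<alpha>\<close>.  As noncommutative
  generating series this is the geometric series inverse to \<open>\<Sum> h\<^sub>\<alpha>\<close>.\<close>

definition dn_antipode_h :: "nat \<times> nat \<Rightarrow> dnsym"
  where "dn_antipode_h \<alpha> = (\<Sum>w\<in>compositions \<alpha>. (- 1) ^ length w *Q h_word w)"

lemma sum_list_eq_0_iff_Nil: "0 \<notin> set w \<Longrightarrow> sum_list w = 0 \<longleftrightarrow> w = []" for w :: "(nat \<times> nat) list"
  by (cases w) (auto simp: nat_prod_add_eq_0)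

lemma dn_antipode_h_0: "dn_antipode_h 0 = 1"
proof -
  have "compositions 0 = {[]}"
    by (auto simp: compositions_def sum_list_eq_0_iff_Nil)
  then show ?thesis
    by (simp add: dn_antipode_h_def scaleQ_one)
qed

lemma compositions_neq_Nil: "\<alpha> \<noteq> 0 \<Longrightarrow> w \<in> compositions \<alpha> \<Longrightarrow> w \<noteq> []"
  by (auto simp: compositions_def)

text \<open>Splitting off the last letter of a nonempty word \<open>v\<close> shows that the term of \<open>v\<close> in \<open>S(h\<^sub>\<alpha>)\<close>, which is the summand with
  \<open>\<gamma> = 0\<close>, cancels against a term with \<open>\<gamma> \<noteq> 0\<close>.  The right-handed version splits off the first letter.\<close>

lemma dn_antipode_h_left:
  assumes "\<alpha> \<noteq> 0" shows "(\<Sum>(\<beta>, \<gamma>) | \<beta> + \<gamma> = \<alpha>. dn_antipode_h \<beta> * dn_h \<gamma>) = 0"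
proof -
  let ?V = "{(\<beta>, \<gamma>). \<beta> + \<gamma> = \<alpha>}" and ?V' = "{(\<beta>, \<gamma>). \<beta> + \<gamma> = \<alpha> \<and> \<gamma> \<noteq> 0}"
  have V: "?V = insert (\<alpha>, 0) ?V'" and fin: "finite ?V'"
    using finite_vector_splittings[of \<alpha>] by (auto elim: rev_finite_subset)
  have "(\<Sum>(\<beta>, \<gamma>)\<in>?V'. dn_antipode_h \<beta> * dn_h \<gamma>) =
      (\<Sum>(\<beta>, \<gamma>)\<in>?V'. \<Sum>w\<in>compositions \<beta>. (- 1) ^ length w *Q h_word (w @ [\<gamma>]))"
    by (simp add: dn_antipode_h_def sum_distrib_right times_simps)
  also have "\<dots> = (\<Sum>((\<beta>, \<gamma>), w)\<in>Sigma ?V' (\<lambda>(\<beta>, \<gamma>). compositions \<beta>). (- 1) ^ length w *Q h_word (w @ [\<gamma>]))"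
    using fin by (subst sum.Sigma[symmetric]) (simp_all add: finite_compositions split_def)
  also have "\<dots> = (\<Sum>w\<in>compositions \<alpha>. - ((- 1) ^ length w *Q h_word w))"
  proof (rule sum.reindex_bij_witness[where j = "\<lambda>((\<beta>, \<gamma>), w). w @ [\<gamma>]" and
        i = "\<lambda>w. ((sum_list (butlast w), last w), butlast w)"], goal_cases)
    case (3 w)
    then show ?case
      using compositions_neq_Nil[OF assms] by auto
  next
    case (4 w)
    then obtain v \<gamma> where "w = v @ [\<gamma>]"
      using compositions_neq_Nil[OF assms] by (metis rev_exhaust)
    with 4 show ?case
      by (auto simp: compositions_def)
  qed (auto simp: compositions_def)
  finally show ?thesis
    using fin by (simp add: V dn_antipode_h_def sum_negf)
qed

lemma dn_antipode_h_right:
  assumes "\<alpha> \<noteq> 0" shows "(\<Sum>(\<beta>, \<gamma>) | \<beta> + \<gamma> = \<alpha>. dn_h \<beta> * dn_antipode_h \<gamma>) = 0"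
proof -
  let ?V = "{(\<beta>, \<gamma>). \<beta> + \<gamma> = \<alpha>}" and ?V' = "{(\<beta>, \<gamma>). \<beta> + \<gamma> = \<alpha> \<and> \<beta> \<noteq> 0}"
  have V: "?V = insert (0, \<alpha>) ?V'" and fin: "finite ?V'"
    using finite_vector_splittings[of \<alpha>] by (auto elim: rev_finite_subset)
  have "(\<Sum>(\<beta>, \<gamma>)\<in>?V'. dn_h \<beta> * dn_antipode_h \<gamma>) =
      (\<Sum>(\<beta>, \<gamma>)\<in>?V'. \<Sum>w\<in>compositions \<gamma>. (- 1) ^ length w *Q h_word (\<beta> # w))"
    by (simp add: dn_antipode_h_def sum_distrib_left times_simps)
  also have "\<dots> = (\<Sum>((\<beta>, \<gamma>), w)\<in>Sigma ?V' (\<lambda>(\<beta>, \<gamma>). compositions \<gamma>). (- 1) ^ length w *Q h_word (\<beta> # w))"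
    using fin by (subst sum.Sigma[symmetric]) (simp_all add: finite_compositions split_def)
  also have "\<dots> = (\<Sum>w\<in>compositions \<alpha>. - ((- 1) ^ length w *Q h_word w))"
  proof (rule sum.reindex_bij_witness[where j = "\<lambda>((\<beta>, \<gamma>), w). \<beta> # w" and
        i = "\<lambda>w. ((hd w, sum_list (tl w)), tl w)"], goal_cases)
    case (3 w)
    then show ?case
      using compositions_neq_Nil[OF assms] by auto
  next
    case (4 w)
    then obtain v \<beta> where "w = \<beta> # v"
      using compositions_neq_Nil[OF assms] by (metis list.exhaust)
    with 4 show ?case
      by (auto simp: compositions_def)
  qed (auto simp: compositions_def)
  finally show ?thesis
    using fin by (simp add: V dn_antipode_h_def sum_negf)
qed

text \<open>The antipode: the antimultiplicative extension of its values on generators.\<close>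

definition dn_antipode :: "dnsym \<Rightarrow> dnsym"
  where "dn_antipode = lin_ext (\<lambda>a. prod_list (map dn_antipode_h (rev (bicomp_list a))))"

lemma linear_dn_antipode: "linearQ dn_antipode"
  unfolding dn_antipode_def by (rule linear_lin_ext)

lemma dn_antipode_1: "dn_antipode 1 = 1"
  by (simp add: dn_antipode_def scaleQ_one zero_bicomp.rep_eq flip: single_one)

lemma dn_antipode_h_word: "0 \<notin> set w \<Longrightarrow> dn_antipode (h_word w) = prod_list (map dn_antipode_h (rev w))"
  using h_word_bicomp_list[of "Abs_bicomp w"] by (simp add: dn_antipode_def scaleQ_one Abs_bicomp_inverse)

lemma dn_antipode_mult_h:
  "dn_antipode (dn_h \<alpha> * x) = dn_antipode x * dn_antipode_h \<alpha>"
  "dn_antipode (x * dn_h \<alpha>) = dn_antipode_h \<alpha> * dn_antipode x"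
proof -
  have lin: "linearQ (\<lambda>x. dn_antipode (dn_h \<alpha> * x))" "linearQ (\<lambda>x. dn_antipode x * dn_antipode_h \<alpha>)"
      "linearQ (\<lambda>x. dn_antipode (x * dn_h \<alpha>))" "linearQ (\<lambda>x. dn_antipode_h \<alpha> * dn_antipode x)"
    by (rule linearQI; simp add: linearQD[OF linear_dn_antipode] times_simps)+
  have word: "dn_antipode (dn_h \<alpha> * h_word w) = dn_antipode (h_word w) * dn_antipode_h \<alpha>"
      "dn_antipode (h_word w * dn_h \<alpha>) = dn_antipode_h \<alpha> * dn_antipode (h_word w)" if "0 \<notin> set w" for w
    using that dn_antipode_h_word[of "\<alpha> # w"] dn_antipode_h_word[of "w @ [\<alpha>]"]
    by (cases "\<alpha> = 0"; simp add: dn_antipode_h_0 dn_antipode_h_word)+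
  show "dn_antipode (dn_h \<alpha> * x) = dn_antipode x * dn_antipode_h \<alpha>"
    by (rule linear_eq_on_basis[OF lin(1,2)])
      (use word(1)[OF bicomp_list_nonzero] in \<open>simp add: h_word_bicomp_list\<close>)
  show "dn_antipode (x * dn_h \<alpha>) = dn_antipode_h \<alpha> * dn_antipode x"
    by (rule linear_eq_on_basis[OF lin(3,4)])
      (use word(2)[OF bicomp_list_nonzero] in \<open>simp add: h_word_bicomp_list\<close>)
qed

lemma dn_antipode_comp: "dn_antipode ` dn_comp d \<subseteq> dn_comp d"
proof safe
  have h: "dn_antipode_h \<alpha> \<in> dn_comp \<alpha>" for \<alpha>
    unfolding dn_antipode_h_def
    by (intro Q.subspace_sum[OF subspace_dn_comp] Q.subspace_scale[OF subspace_dn_comp])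
      (use dn_comp_h_word in \<open>auto simp: compositions_def\<close>)
  fix x assume "x \<in> dn_comp d"
  then show "dn_antipode x \<in> dn_comp d"
  proof (rule dn_comp_induct[OF _ linear_dn_antipode subspace_dn_comp])
    fix w assume "0 \<notin> set w" "sum_list w = d"
    then show "dn_antipode (h_word w) \<in> dn_comp d"
      using dn_comp_prod_list[OF h, of "rev w"] by (simp add: dn_antipode_h_word sum_list_rev)
  qed
qed

lemma tensor_lift_mult_pure:
  assumes B: "bilinearQ B"
  shows "tensor_lift B ((p \<otimes> q) \<bullet> t) = tensor_lift (\<lambda>a b. B (p * a) (q * b)) t"
    and "tensor_lift B (t \<bullet> (p \<otimes> q)) = tensor_lift (\<lambda>a b. B (a * p) (b * q)) t"
proof -
  have bil: "bilinearQ (\<lambda>a b. B (p * a) (q * b))" "bilinearQ (\<lambda>a b. B (a * p) (b * q))"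
    by (rule bilinearQI; simp add: bilinearQ_simps[OF B] times_simps)+
  show "tensor_lift B ((p \<otimes> q) \<bullet> t) = tensor_lift (\<lambda>a b. B (p * a) (q * b)) t"
    by (rule linear_eq_on_pure[where t = t, OF
          linearQ_compose[OF linear_tensor_lift[OF B] bilinearQ_right[OF bilinear_dn_tensor_mult]]
          linear_tensor_lift[OF bil(1)]])
      (simp add: tensor_lift_pure B bil dn_tensor_mult_pure)
  show "tensor_lift B (t \<bullet> (p \<otimes> q)) = tensor_lift (\<lambda>a b. B (a * p) (b * q)) t"
    by (rule linear_eq_on_pure[where t = t, OF
          linearQ_compose[OF linear_tensor_lift[OF B] bilinearQ_left[OF bilinear_dn_tensor_mult]]
          linear_tensor_lift[OF bil(2)]])
      (simp add: tensor_lift_pure B bil dn_tensor_mult_pure)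
qed

text \<open>On \<open>h\<^sub>\<alpha> * x\<close> with \<open>\<alpha> \<noteq> 0\<close> antimultiplicativity gives the sum over \<open>\<beta> + \<gamma> = \<alpha>\<close> of the values of
  \<open>a \<otimes> b \<mapsto> S a * (S(h\<^sub>\<beta>) * h\<^sub>\<gamma>) * b\<close> at the coproduct of \<open>x\<close>, which vanishes by \<open>dn_antipode_h_left\<close>.\<close>

lemma dn_antipode_left: "tensor_lift (\<lambda>a b. dn_antipode a * b) (dn_comult x) = dn_counit x *Q 1"
proof -
  let ?B = "\<lambda>c a b. dn_antipode a * c * b"
  have B1: "bilinearQ (\<lambda>a b. dn_antipode a * b)" and B: "bilinearQ (?B c)" for c
    by (rule bilinearQI; simp add: linearQD[OF linear_dn_antipode] times_simps)+
  have linB: "linearQ (\<lambda>c. tensor_lift (?B c) t)" for t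
    by (rule linear_tensor_lift_param[OF B], rule linearQI) (simp_all add: times_simps)
  show ?thesis
  proof (rule dn_linear_eq_Cons[where x = x])
    show "linearQ (\<lambda>x. tensor_lift (\<lambda>a b. dn_antipode a * b) (dn_comult x))"
      by (rule linearQ_compose[OF linear_tensor_lift[OF B1] linear_dn_comult])
    show "linearQ (\<lambda>x. dn_counit x *Q 1)"
      by (rule linearQI) (simp_all add: linearQD[OF linear_dn_counit] scaleQ_add_left scaleQ_scaleQ scaleQ_rat_def)
    show "tensor_lift (\<lambda>a b. dn_antipode a * b) (dn_comult 1) = dn_counit 1 *Q 1"
      by (simp add: dn_comult_1 tensor_lift_pure B1 dn_antipode_1 dn_counit_eq scaleQ_one)
    fix \<alpha> :: "nat \<times> nat" and x assume \<alpha>: "\<alpha> \<noteq> 0"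
    have "tensor_lift (\<lambda>a b. dn_antipode a * b) (dn_comult (dn_h \<alpha> * x)) =
        (\<Sum>(\<beta>, \<gamma>) | \<beta> + \<gamma> = \<alpha>. tensor_lift (?B (dn_antipode_h \<beta> * dn_h \<gamma>)) (dn_comult x))"
      by (simp add: dn_comult_mult dn_comult_dn_h dn_comult_h_def split_def mult.assoc
          linearQ_sum[OF bilinearQ_left[OF bilinear_dn_tensor_mult]] linearQ_sum[OF linear_tensor_lift[OF B1]]
          tensor_lift_mult_pure[OF B1] dn_antipode_mult_h)
    also have "\<dots> = tensor_lift (?B (\<Sum>(\<beta>, \<gamma>) | \<beta> + \<gamma> = \<alpha>. dn_antipode_h \<beta> * dn_h \<gamma>)) (dn_comult x)"
      unfolding linearQ_sum[OF linB] by (simp add: split_def)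
    also have "\<dots> = 0"
      unfolding dn_antipode_h_left[OF \<alpha>] by (rule linearQD(3)[OF linB])
    finally show "tensor_lift (\<lambda>a b. dn_antipode a * b) (dn_comult (dn_h \<alpha> * x)) = dn_counit (dn_h \<alpha> * x) *Q 1"
      using \<alpha> by (simp add: dn_counit_mult dn_counit_h)
  qed
qed

text \<open>The mirror image of the left-handed law, evaluated on products \<open>x * h\<^sub>\<alpha>\<close>.\<close>

lemma dn_antipode_right: "tensor_lift (\<lambda>a b. a * dn_antipode b) (dn_comult x) = dn_counit x *Q 1"
proof -
  let ?B = "\<lambda>c a b. a * c * dn_antipode b"
  have B1: "bilinearQ (\<lambda>a b. a * dn_antipode b)" and B: "bilinearQ (?B c)" for c
    by (rule bilinearQI; simp add: linearQD[OF linear_dn_antipode] times_simps)+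
  have linB: "linearQ (\<lambda>c. tensor_lift (?B c) t)" for t
    by (rule linear_tensor_lift_param[OF B], rule linearQI) (simp_all add: times_simps)
  show ?thesis
  proof (rule dn_linear_eq_snoc[where x = x])
    show "linearQ (\<lambda>x. tensor_lift (\<lambda>a b. a * dn_antipode b) (dn_comult x))"
      by (rule linearQ_compose[OF linear_tensor_lift[OF B1] linear_dn_comult])
    show "linearQ (\<lambda>x. dn_counit x *Q 1)"
      by (rule linearQI) (simp_all add: linearQD[OF linear_dn_counit] scaleQ_add_left scaleQ_scaleQ scaleQ_rat_def)
    show "tensor_lift (\<lambda>a b. a * dn_antipode b) (dn_comult 1) = dn_counit 1 *Q 1"
      by (simp add: dn_comult_1 tensor_lift_pure B1 dn_antipode_1 dn_counit_eq scaleQ_one)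
    fix \<alpha> :: "nat \<times> nat" and x assume \<alpha>: "\<alpha> \<noteq> 0"
    have "tensor_lift (\<lambda>a b. a * dn_antipode b) (dn_comult (x * dn_h \<alpha>)) =
        (\<Sum>(\<beta>, \<gamma>) | \<beta> + \<gamma> = \<alpha>. tensor_lift (?B (dn_h \<beta> * dn_antipode_h \<gamma>)) (dn_comult x))"
      by (simp add: dn_comult_mult dn_comult_dn_h dn_comult_h_def split_def mult.assoc
          linearQ_sum[OF bilinearQ_right[OF bilinear_dn_tensor_mult]] linearQ_sum[OF linear_tensor_lift[OF B1]]
          tensor_lift_mult_pure[OF B1] dn_antipode_mult_h)
    also have "\<dots> = tensor_lift (?B (\<Sum>(\<beta>, \<gamma>) | \<beta> + \<gamma> = \<alpha>. dn_h \<beta> * dn_antipode_h \<gamma>)) (dn_comult x)"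
      unfolding linearQ_sum[OF linB] by (simp add: split_def)
    also have "\<dots> = 0"
      unfolding dn_antipode_h_right[OF \<alpha>] by (rule linearQD(3)[OF linB])
    finally show "tensor_lift (\<lambda>a b. a * dn_antipode b) (dn_comult (x * dn_h \<alpha>)) = dn_counit (x * dn_h \<alpha>) *Q 1"
      using \<alpha> by (simp add: dn_counit_mult dn_counit_h)
  qed
qed

lemma DNSym_simps:
  "hmult DNSym = (*)" "hunit DNSym = 1" "hcomult DNSym = dn_comult" "hcounit DNSym = dn_counit" "hcomp DNSym = dn_comp"
  by (simp_all add: DNSym_def span_dn_word)

lemma bigraded_hopf_algebra_DNSym: "bigraded_hopf_algebra DNSym"
proof (rule bigraded_hopf_algebra.intro; unfold DNSym_simps)
  show "dn_counit x = 0" if "x \<in> dn_comp d" "d \<noteq> 0" for x d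
    using that by (auto simp: dn_counit_eq mem_dn_comp_iff bidegree_def zero_bicomp.rep_eq)
  show "dn_counit 1 = 1"
    by (simp add: dn_counit_eq)
  show "\<exists>S. linearQ S \<and> (\<forall>d. S ` dn_comp d \<subseteq> dn_comp d) \<and>
      (\<forall>x. tensor_lift (\<lambda>a b. S a * b) (dn_comult x) = dn_counit x *Q 1) \<and>
      (\<forall>x. tensor_lift (\<lambda>a b. a * S b) (dn_comult x) = dn_counit x *Q 1)"
    using linear_dn_antipode dn_antipode_comp dn_antipode_left dn_antipode_right by blast
qed (fact bilinear_times mult.assoc mult_1_left mult_1_right linear_dn_comult linear_dn_counit dn_coassoc
    dn_counit_left dn_counit_right dn_comult_mult dn_comult_1 dn_counit_mult subspace_dn_comp dn_comp_direct_sum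
    dn_comp_mult dn_comp_1 dn_comp_comult[unfolded dn_tensor_comp_def])+

section \<open>The pairing of DNSym with DQSym\<close>

lemma DQSym_simps:
  "hmult DQSym = dq_mult" "hunit DQSym = dq_M 0" "hcomult DQSym = dq_comult" "hcounit DQSym = dq_counit"
  "hcomp DQSym d = Q.span (dq_M ` {a. bidegree a = d})"
  by (simp_all add: DQSym_def)

lemma dq_linear_eq:
  assumes F: "linearQ F" and G: "linearQ G" and eq: "\<And>a. F (dq_M a) = G (dq_M a)"
  shows "F f = G f"
proof -
  have "F (lin_ext dq_M (dq_coords f)) = G (lin_ext dq_M (dq_coords f))"
    by (rule linear_eq_on_basis[OF linearQ_compose[OF F linear_lin_ext] linearQ_compose[OF G linear_lin_ext]])
      (simp add: scaleQ_one eq)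
  then show ?thesis by simp
qed

lemma vanishes_on_comp_iff:
  assumes "linearQ \<chi>"
  shows "(\<forall>f\<in>hcomp DQSym d. \<chi> f = 0) \<longleftrightarrow> (\<forall>a. bidegree a = d \<longrightarrow> \<chi> (dq_M a) = 0)"
proof (intro iffI allI impI ballI)
  fix f assume 0: "\<forall>a. bidegree a = d \<longrightarrow> \<chi> (dq_M a) = 0" and "f \<in> hcomp DQSym d"
  from this(2)[unfolded DQSym_simps] show "\<chi> f = 0"
  proof (induction rule: Q.span_induct)
    case base
    show ?case
      by (rule Q.subspaceI) (simp_all add: linearQD[OF assms])
  qed (use 0 in auto)
qed (auto simp: DQSym_simps Q.span_base)

lemma linear_dual_eval: "linearQ (dual_eval \<phi>)"
  using dual_eval[of \<phi>] by (simp add: graded_dual_def)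

lemma linear_dual_eval_at: "linearQ (\<lambda>\<phi>. dual_eval \<phi> f)"
  by (rule linearQI) (simp_all add: plus_dqsym_dual.rep_eq scaleQ_dqsym_dual.rep_eq scaleQ_fun_def)

lemma dual_eqI: "(\<And>a. dual_eval \<phi> (dq_M a) = dual_eval \<psi> (dq_M a)) \<Longrightarrow> \<phi> = \<psi>"
  by (rule dual_eval_inject[THEN iffD1], rule ext) (rule dq_linear_eq[OF linear_dual_eval linear_dual_eval])

text \<open>The isomorphism: the word \<open>a\<close> goes to the functional dual to \<open>M\<^sub>a\<close>.  A finite linear combination \<open>x\<close> of words
  thus becomes the functional whose value at \<open>M\<^sub>a\<close> is the coefficient of \<open>a\<close> in \<open>x\<close>.\<close>

definition dn_dual :: "dnsym \<Rightarrow> dqsym_dual"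
  where "dn_dual x = Abs_dqsym_dual (\<lambda>f. lin_ext (Poly_Mapping.lookup x) (dq_coords f))"

lemma dual_eval_dn_dual: "dual_eval (dn_dual x) f = lin_ext (Poly_Mapping.lookup x) (dq_coords f)"
proof -
  let ?\<chi> = "\<lambda>f. lin_ext (Poly_Mapping.lookup x) (dq_coords f)"
  have lin: "linearQ ?\<chi>"
    by (rule linearQ_compose[OF linear_lin_ext linear_dq_coords])
  have "d \<in> bidegree ` Poly_Mapping.keys x" if nz: "\<exists>f\<in>hcomp DQSym d. ?\<chi> f \<noteq> 0" for d
  proof -
    obtain a where "bidegree a = d" "?\<chi> (dq_M a) \<noteq> 0"
      using nz vanishes_on_comp_iff[OF lin, of d] by blast
    then show ?thesis
      by (auto simp: scaleQ_one in_keys_iff)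
  qed
  then have "finite {d. \<exists>f\<in>hcomp DQSym d. ?\<chi> f \<noteq> 0}"
    by (intro finite_subset[OF _ finite_imageI[OF finite_keys, of bidegree x]]) blast
  with lin have "?\<chi> \<in> graded_dual (hcomp DQSym)"
    by (simp add: graded_dual_def)
  then show ?thesis
    by (simp add: dn_dual_def Abs_dqsym_dual_inverse)
qed

lemma dual_eval_dn_dual_M: "dual_eval (dn_dual x) (dq_M a) = Poly_Mapping.lookup x a"
  by (simp add: dual_eval_dn_dual scaleQ_one)

lemma linear_dn_dual: "linearQ dn_dual"
  by (intro linearQI dual_eqI) (simp_all add: plus_dqsym_dual.rep_eq scaleQ_dqsym_dual.rep_eq scaleQ_fun_def
    dual_eval_dn_dual_M lookup_add)

lemma finite_bidegree: "finite {a. bidegree a = d}"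
proof (rule finite_imageD)
  show "finite (bicomp_list ` {a. bidegree a = d})"
    by (rule finite_subset[OF _ finite_compositions[of d]])
      (auto simp: compositions_def bidegree_def bicomp_list_nonzero)
qed (simp add: inj_on_def bicomp_list_inject)

text \<open>Surjectivity: a functional in the graded dual lives on finitely many bidegrees, each of which carries only
  finitely many words, so its values on the \<open>M\<^sub>a\<close> are the coefficients of an element of DNSym.\<close>

lemma bij_dn_dual: "bij dn_dual"
proof (rule bijI)
  show "inj dn_dual"
    by (rule injI, rule poly_mapping_eqI) (metis dual_eval_dn_dual_M)
  show "surj dn_dual"
  proof (rule surjI)
    fix \<phi>
    let ?c = "\<lambda>a. dual_eval \<phi> (dq_M a)"
    have "finite {d. \<exists>f\<in>hcomp DQSym d. dual_eval \<phi> f \<noteq> 0}"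
      using dual_eval[of \<phi>] by (simp add: graded_dual_def)
    then have "finite (\<Union>d\<in>{d. \<exists>f\<in>hcomp DQSym d. dual_eval \<phi> f \<noteq> 0}. {a. bidegree a = d})"
      by (simp add: finite_bidegree)
    moreover have "{a. ?c a \<noteq> 0} \<subseteq> \<dots>"
      using vanishes_on_comp_iff[OF linear_dual_eval] by fastforce
    ultimately have "finite {a. ?c a \<noteq> 0}"
      by (rule rev_finite_subset)
    then show "dn_dual (Abs_poly_mapping ?c) = \<phi>"
      by (intro dual_eqI) (simp add: dual_eval_dn_dual_M)
  qed
qed

lemma finite_factorizations: "finite {(a\<^sub>1, a\<^sub>2). a\<^sub>1 + a\<^sub>2 = (a :: bicomp)}"
proof (rule finite_subset)
  show "{(a\<^sub>1, a\<^sub>2). a\<^sub>1 + a\<^sub>2 = a} \<subseteq>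
      (\<lambda>n. (Abs_bicomp (take n (bicomp_list a)), Abs_bicomp (drop n (bicomp_list a)))) ` {..length (bicomp_list a)}"
  proof safe
    fix a\<^sub>1 a\<^sub>2
    show "(a\<^sub>1, a\<^sub>2) \<in> (\<lambda>n. (Abs_bicomp (take n (bicomp_list (a\<^sub>1 + a\<^sub>2))),
        Abs_bicomp (drop n (bicomp_list (a\<^sub>1 + a\<^sub>2))))) ` {..length (bicomp_list (a\<^sub>1 + a\<^sub>2))}"
      by (rule image_eqI[of _ _ "length (bicomp_list a\<^sub>1)"]) (simp_all add: plus_bicomp.rep_eq bicomp_list_inverse)
  qed
qed simp

lemma dual_eval_mult_M:
  "dual_eval (dual_mult \<phi> \<psi>) (dq_M c) = (\<Sum>(a, b) | a + b = c. dual_eval \<phi> (dq_M a) * dual_eval \<psi> (dq_M b))"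
proof -
  note bil = bilinear_functional_product[OF linear_dual_eval linear_dual_eval]
  show ?thesis
    by (simp add: dual_mult.rep_eq DQSym_simps dq_comult_def scaleQ_one linearQ_sum[OF linear_tensor_lift[OF bil]]
        split_def tensor_lift_pure[OF bil])
qed

lemma dn_dual_mult: "dn_dual (x * y) = dual_mult (dn_dual x) (dn_dual y)"
proof (rule dual_eqI)
  fix c
  have "Poly_Mapping.lookup (x * y) c = (\<Sum>(a, b) | a + b = c. Poly_Mapping.lookup x a * Poly_Mapping.lookup y b)"
  proof (rule linear_eq_on_basis[where p = x])
    show "linearQ (\<lambda>x. Poly_Mapping.lookup (x * y) c)"
      by (rule linearQI) (simp_all add: times_simps lookup_add)
    show "linearQ (\<lambda>x. \<Sum>(a, b) | a + b = c. Poly_Mapping.lookup x a * Poly_Mapping.lookup y b)"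
      by (rule linearQI) (simp_all add: lookup_add split_def algebra_simps sum.distrib sum_distrib_left scaleQ_rat_def)
    fix a'
    show "Poly_Mapping.lookup (Poly_Mapping.single a' 1 * y) c =
      (\<Sum>(a, b) | a + b = c. Poly_Mapping.lookup (Poly_Mapping.single a' 1) a * Poly_Mapping.lookup y b)"
    proof (rule linear_eq_on_basis[where p = y])
      show "linearQ (\<lambda>y :: dnsym. Poly_Mapping.lookup (Poly_Mapping.single a' 1 * y) c)"
        by (rule linearQI) (simp_all add: times_simps lookup_add)
      show "linearQ (\<lambda>y :: dnsym. \<Sum>(a, b) | a + b = c. Poly_Mapping.lookup (Poly_Mapping.single a' 1) a * Poly_Mapping.lookup y b)"
        by (rule linearQI) (simp_all add: lookup_add split_def algebra_simps sum.distrib sum_distrib_left scaleQ_rat_def)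
      fix b'
      have "(\<Sum>(a, b) | a + b = c. Poly_Mapping.lookup (Poly_Mapping.single a' (1 :: rat)) a *
            Poly_Mapping.lookup (Poly_Mapping.single b' (1 :: rat)) b) =
          (\<Sum>p\<in>{(a, b). a + b = c}. if p = (a', b') then 1 else 0)"
        by (rule sum.cong) (auto simp: lookup_single when_def split: if_splits)
      also have "\<dots> = Poly_Mapping.lookup (Poly_Mapping.single a' 1 * Poly_Mapping.single b' 1) c"
        by (simp add: finite_factorizations mult_single lookup_single when_def)
      finally show "Poly_Mapping.lookup (Poly_Mapping.single a' (1 :: rat) * Poly_Mapping.single b' (1 :: rat)) c =
          (\<Sum>(a, b) | a + b = c. Poly_Mapping.lookup (Poly_Mapping.single a' (1 :: rat)) a *
            Poly_Mapping.lookup (Poly_Mapping.single b' (1 :: rat)) b)" ..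
    qed
  qed
  then show "dual_eval (dn_dual (x * y)) (dq_M c) = dual_eval (dual_mult (dn_dual x) (dn_dual y)) (dq_M c)"
    by (simp add: dual_eval_dn_dual_M dual_eval_mult_M)
qed

lemma dn_dual_1: "dn_dual 1 = dual_unit"
  by (rule dual_eqI) (simp add: dual_eval_dn_dual_M dual_unit.rep_eq DQSym_simps dq_counit_def scaleQ_one lookup_one when_def)

lemma dn_dual_counit: "dual_counit (dn_dual x) = dn_counit x"
  by (simp add: dual_counit_def DQSym_simps dual_eval_dn_dual_M dn_counit_eq)

lemma dn_dual_comp: "dn_dual ` dn_comp d = hcomp DQSym_dual d"
proof -
  have "dn_dual x \<in> hcomp DQSym_dual d \<longleftrightarrow> x \<in> dn_comp d" for x
    by (simp add: DQSym_dual_def vanishes_on_comp_iff[OF linear_dual_eval] dual_eval_dn_dual_M mem_dn_comp_iff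
        del: split_paired_All) blast
  then show ?thesis
    using bij_is_surj[OF bij_dn_dual] by (auto simp: set_eq_iff image_iff) (metis surjD)
qed

section \<open>The coproduct of DNSym is dual to the product of DQSym\<close>

lemma splittings_ConsI: "\<beta> + \<gamma> = \<alpha> \<Longrightarrow> (u, v) \<in> splittings w \<Longrightarrow> (\<beta> # u, \<gamma> # v) \<in> splittings (\<alpha> # w)"
  by (simp add: splittings_def)

lemma splittings_ConsE:
  assumes "p \<in> splittings (\<alpha> # w)"
  obtains \<beta> u \<gamma> v where "p = (\<beta> # u, \<gamma> # v)" "\<beta> + \<gamma> = \<alpha>" "(u, v) \<in> splittings w"
  using assms by (auto simp: splittings_def length_Suc_conv)

text \<open>The coproduct of a word: split every letter into two, zero being allowed.\<close>

lemma dn_comult_h_word_splittings: "dn_comult (h_word w) = (\<Sum>(u, v)\<in>splittings w. h_word u \<otimes> h_word v)"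
proof (induction w)
  case Nil
  have "splittings [] = {([], [])}"
    by (auto simp: splittings_def)
  then show ?case
    by (simp add: dn_comult_1)
next
  case (Cons \<alpha> w)
  have "dn_comult (h_word (\<alpha> # w)) =
      (\<Sum>(\<beta>, \<gamma>) | \<beta> + \<gamma> = \<alpha>. dn_h \<beta> \<otimes> dn_h \<gamma>) \<bullet> (\<Sum>(u, v)\<in>splittings w. h_word u \<otimes> h_word v)"
    by (simp add: dn_comult_mult dn_comult_dn_h dn_comult_h_def Cons)
  also have "\<dots> = (\<Sum>(\<beta>, \<gamma>) | \<beta> + \<gamma> = \<alpha>. \<Sum>(u, v)\<in>splittings w. h_word (\<beta> # u) \<otimes> h_word (\<gamma> # v))"
    by (simp add: linearQ_sum[OF bilinearQ_left[OF bilinear_dn_tensor_mult]]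
        linearQ_sum[OF bilinearQ_right[OF bilinear_dn_tensor_mult]] split_def dn_tensor_mult_pure)
      (rule sum.swap)
  also have "\<dots> = (\<Sum>((\<beta>, \<gamma>), u, v)\<in>{(\<beta>, \<gamma>). \<beta> + \<gamma> = \<alpha>} \<times> splittings w. h_word (\<beta> # u) \<otimes> h_word (\<gamma> # v))"
    unfolding split_def by (rule sum.cartesian_product[unfolded split_def])
  also have "\<dots> = (\<Sum>(u, v)\<in>splittings (\<alpha> # w). h_word u \<otimes> h_word v)"
  proof (rule sum.reindex_bij_witness[where i = "\<lambda>(u, v). ((hd u, hd v), tl u, tl v)" and
        j = "\<lambda>((\<beta>, \<gamma>), u, v). (\<beta> # u, \<gamma> # v)"], goal_cases)
    case (3 p)
    then obtain \<beta> u \<gamma> v where "p = (\<beta> # u, \<gamma> # v)" "\<beta> + \<gamma> = \<alpha>" "(u, v) \<in> splittings w"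
      by (rule splittings_ConsE)
    then show ?case by simp
  next
    case (4 p)
    then obtain \<beta> u \<gamma> v where "p = (\<beta> # u, \<gamma> # v)" "\<beta> + \<gamma> = \<alpha>" "(u, v) \<in> splittings w"
      by (rule splittings_ConsE)
    then show ?case by simp
  next
    case (2 p)
    then show ?case by (auto intro: splittings_ConsI)
  qed auto
  finally show ?case .
qed

lemma bilinear_eval_product: "bilinearQ (\<lambda>\<psi> \<chi>. dual_eval \<psi> f * dual_eval \<chi> g)"
  by (rule bilinearQI) (simp_all add: linearQD[OF linear_dual_eval_at] algebra_simps scaleQ_rat_def)

lemma bilinear_lookup_product:
  "bilinearQ (\<lambda>x y. Poly_Mapping.lookup x a * Poly_Mapping.lookup y b :: rat)"
  by (rule bilinearQI) (simp_all add: lookup_add algebra_simps scaleQ_rat_def)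

text \<open>The structure constants of DQSym: the coefficient of \<open>M\<^sub>c\<close> in a series of DQSym is its coefficient at any
  monomial of shape \<open>c\<close>.\<close>

lemma lookup_dq_coords_mult_M:
  "Poly_Mapping.lookup (dq_coords (dq_mult (dq_M a) (dq_M b))) c = quasi_shuffle_coeff a b c"
proof -
  obtain m where m: "shape m = c"
    using shape_surj by blast
  have "Poly_Mapping.lookup (dq_coords (dq_mult (dq_M a) (dq_M b))) c = dq_series (dq_mult (dq_M a) (dq_M b)) m"
    using dq_series_lin_ext[of "dq_coords (dq_mult (dq_M a) (dq_M b))" m] by (simp add: m)
  also have "\<dots> = quasi_shuffle_coeff a b c"
    by (simp add: dq_mult.rep_eq dq_M.rep_eq series_mult_M m)
  finally show ?thesis .
qed

lemma dual_eval_dn_dual_single: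
  "dual_eval (dn_dual (Poly_Mapping.single c 1)) f = Poly_Mapping.lookup (dq_coords f) c"
proof (rule dq_linear_eq[where f = f])
  show "linearQ (dual_eval (dn_dual (Poly_Mapping.single c 1)))"
    by (rule linear_dual_eval)
  show "linearQ (\<lambda>f. Poly_Mapping.lookup (dq_coords f) c)"
    by (rule linearQ_compose[OF linearQ_lookup linear_dq_coords])
qed (simp add: dual_eval_dn_dual_M lookup_single when_def eq_commute)

lemma bilinear_dq_mult: "bilinearQ dq_mult"
  by (rule bilinearQI; transfer; simp add: bilinearQ_simps[OF bilinear_series_mult])

text \<open>The coproduct of DNSym is adjoint to the product of DQSym: at \<open>M\<^sub>a\<close>, \<open>M\<^sub>b\<close> and a word \<open>c\<close>, both sides count the
  splittings of \<open>c\<close> that become \<open>a\<close> and \<open>b\<close> when zeros are deleted.\<close>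

lemma dn_dual_comult_pairing:
  "tensor_lift (\<lambda>\<psi> \<chi>. dual_eval \<psi> f * dual_eval \<chi> g) (tensor_map dn_dual dn_dual (dn_comult x)) =
    dual_eval (dn_dual x) (dq_mult f g)"
proof -
  let ?E = "\<lambda>f g x. tensor_lift (\<lambda>x y. dual_eval (dn_dual x) f * dual_eval (dn_dual y) g) (dn_comult x)"
  have bil: "bilinearQ (\<lambda>x y. dual_eval (dn_dual x) f * dual_eval (dn_dual y) g)" for f g
    using bilinearQ_compose[OF bilinear_eval_product linear_dn_dual linear_dn_dual linearQ_ident] .
  \<comment> \<open>All three arguments enter linearly, so it is enough to treat basis elements.\<close>
  have word: "?E (dq_M a) (dq_M b) (Poly_Mapping.single c 1) = quasi_shuffle_coeff a b c" for a b c
  proof -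
    have lookup: "Poly_Mapping.lookup (h_word u) d = of_bool (filter (\<lambda>\<alpha>. \<alpha> \<noteq> 0) u = bicomp_list d)" for u d
    proof -
      have "Abs_bicomp (filter (\<lambda>\<alpha>. \<alpha> \<noteq> 0) u) = d \<longleftrightarrow> filter (\<lambda>\<alpha>. \<alpha> \<noteq> 0) u = bicomp_list d"
        using Abs_bicomp_inverse[of "filter (\<lambda>\<alpha>. \<alpha> \<noteq> 0) u"] bicomp_list_inverse[of d] by auto
      then show ?thesis
        by (simp add: h_word_filter lookup_single when_def)
    qed
    have "?E (dq_M a) (dq_M b) (h_word (bicomp_list c)) =
        (\<Sum>(u, v)\<in>splittings (bicomp_list c). Poly_Mapping.lookup (h_word u) a * Poly_Mapping.lookup (h_word v) b)"
      unfolding dn_comult_h_word_splittings linearQ_sum[OF linear_tensor_lift[OF bil]]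
      by (simp add: split_def tensor_lift_pure[OF bilinear_lookup_product] dual_eval_dn_dual_M)
    then show ?thesis
      by (simp add: lookup quasi_shuffle_coeff_def h_word_bicomp_list)
  qed
  have linf: "linearQ (\<lambda>f. ?E f g x)" "linearQ (\<lambda>g. ?E f g x)" for f g x
    by (rule linear_tensor_lift_param[OF bil], rule linearQI;
        simp add: linearQD[OF linear_dual_eval] algebra_simps scaleQ_rat_def)+
  have lin_mult: "linearQ (\<lambda>f. dual_eval (dn_dual x) (dq_mult f g))" "linearQ (\<lambda>g. dual_eval (dn_dual x) (dq_mult f g))"
    for f g x
    by (rule linearQ_compose[OF linear_dual_eval] bilinearQ_left bilinearQ_right bilinear_dq_mult)+
  have "?E f g x = dual_eval (dn_dual x) (dq_mult f g)"
  proof (rule linear_eq_on_basis[where p = x])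
    show "linearQ (?E f g)"
      by (rule linearQ_compose[OF linear_tensor_lift[OF bil] linear_dn_comult])
    show "linearQ (\<lambda>x. dual_eval (dn_dual x) (dq_mult f g))"
      by (rule linearQ_compose[OF linear_dual_eval_at linear_dn_dual])
    show "?E f g (Poly_Mapping.single c 1) = dual_eval (dn_dual (Poly_Mapping.single c 1)) (dq_mult f g)" for c
      by (rule dq_linear_eq[OF linf(1) lin_mult(1)], rule dq_linear_eq[OF linf(2) lin_mult(2)])
        (simp add: word dual_eval_dn_dual_single lookup_dq_coords_mult_M)
  qed
  then show ?thesis
    by (simp add: tensor_lift_map[OF bilinear_eval_product linear_dn_dual linear_dn_dual])
qed

lemma tensor_eq_combination:
  fixes t :: "('k \<Rightarrow>\<^sub>0 rat, 'l \<Rightarrow>\<^sub>0 rat) tensor"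
  shows "\<exists>p. t = lin_ext (\<lambda>(a, b). Poly_Mapping.single a 1 \<otimes> Poly_Mapping.single b 1) p"
proof (induction t rule: tensor_induct)
  let ?L = "lin_ext (\<lambda>(a, b). Poly_Mapping.single a 1 \<otimes> Poly_Mapping.single b (1::rat))"
  case (add s t)
  then obtain p q where "s = ?L p" "t = ?L q"
    by blast
  then have "s + t = ?L (p + q)"
    by (simp add: linearQD[OF linear_lin_ext])
  then show ?case ..
next
  case (pure x y)
  let ?L = "lin_ext (\<lambda>(a, b). Poly_Mapping.single a 1 \<otimes> Poly_Mapping.single b (1::rat))"
  have "x \<otimes> y = (\<Sum>a\<in>Poly_Mapping.keys x. \<Sum>b\<in>Poly_Mapping.keys y.
      (Poly_Mapping.lookup x a * Poly_Mapping.lookup y b) *Q (Poly_Mapping.single a 1 \<otimes> Poly_Mapping.single b 1))"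
    by (subst lin_ext_basis[of x, symmetric], subst lin_ext_basis[of y, symmetric], unfold lin_ext_def,
        simp add: linearQ_sum[OF bilinearQ_left[OF bilinear_tensor_pure]]
          linearQ_sum[OF bilinearQ_right[OF bilinear_tensor_pure]] pure_simps scaleQ_scaleQ Q.scale_sum_right mult.commute)
      (rule sum.swap)
  also have "\<dots> = ?L (\<Sum>a\<in>Poly_Mapping.keys x. \<Sum>b\<in>Poly_Mapping.keys y.
      Poly_Mapping.single (a, b) (Poly_Mapping.lookup x a * Poly_Mapping.lookup y b))"
    by (simp add: linearQ_sum[OF linear_lin_ext])
  finally show ?case ..
qed

text \<open>Tensors of free vector spaces are determined by their coefficients.  This gives the uniqueness
  implicit in the definition of \<open>dual_comult\<close>.\<close>

lemma tensor_eq_by_coefficients: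
  fixes s t :: "('k \<Rightarrow>\<^sub>0 rat, 'l \<Rightarrow>\<^sub>0 rat) tensor"
  assumes eq: "\<And>a b. tensor_lift (\<lambda>x y. Poly_Mapping.lookup x a * Poly_Mapping.lookup y b) s =
    tensor_lift (\<lambda>x y. Poly_Mapping.lookup x a * Poly_Mapping.lookup y b) t"
  shows "s = t"
proof -
  let ?L = "lin_ext (\<lambda>(a, b). Poly_Mapping.single a 1 \<otimes> Poly_Mapping.single b (1::rat))"
  have coeff: "tensor_lift (\<lambda>x y. Poly_Mapping.lookup x a * Poly_Mapping.lookup y b) (?L p) = Poly_Mapping.lookup p (a, b)"
    for p :: "'k \<times> 'l \<Rightarrow>\<^sub>0 rat" and a b
    by (rule linear_eq_on_basis[where p = p,
          OF linearQ_compose[OF linear_tensor_lift[OF bilinear_lookup_product] linear_lin_ext] linearQ_lookup])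
      (auto simp: scaleQ_one tensor_lift_pure[OF bilinear_lookup_product] lookup_single when_def split: if_splits)
  obtain p q where s: "s = ?L p" and t: "t = ?L q"
    using tensor_eq_combination by metis
  have "p = q"
    by (rule poly_mapping_eqI) (use eq in \<open>simp add: s t coeff split_paired_all\<close>)
  then show ?thesis
    by (simp add: s t)
qed

lemma dn_dual_comult: "dual_comult (dn_dual x) = tensor_map dn_dual dn_dual (dn_comult x)"
  unfolding dual_comult_def DQSym_simps
proof (rule the_equality)
  show "\<forall>f g. tensor_lift (\<lambda>\<psi> \<chi>. dual_eval \<psi> f * dual_eval \<chi> g) (tensor_map dn_dual dn_dual (dn_comult x)) =
      dual_eval (dn_dual x) (dq_mult f g)"
    by (simp add: dn_dual_comult_pairing)
  fix t assume t: "\<forall>f g. tensor_lift (\<lambda>\<psi> \<chi>. dual_eval \<psi> f * dual_eval \<chi> g) t = dual_eval (dn_dual x) (dq_mult f g)"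
  have inv: "dn_dual (inv dn_dual y) = y" for y
    using bij_dn_dual by (simp add: bij_is_surj surj_f_inv_f)
  have lin_inv: "linearQ (inv dn_dual)"
    by (rule linearQI) (metis bij_dn_dual bij_inv_eq_iff inv linearQD(1,2)[OF linear_dn_dual])+
  \<comment> \<open>Pulling \<open>t\<close> back to the tensor square of DNSym makes coefficients available for comparison.\<close>
  define s where "s = tensor_map (inv dn_dual) (inv dn_dual) t"
  have ts: "t = tensor_map dn_dual dn_dual s"
    unfolding s_def
    by (rule linear_eq_on_pure[where t = t, OF linearQ_ident
          linearQ_compose[OF linear_tensor_map[OF linear_dn_dual linear_dn_dual] linear_tensor_map[OF lin_inv lin_inv]]])
      (simp add: tensor_map_pure linear_dn_dual lin_inv inv)
  have "s = dn_comult x"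
  proof (rule tensor_eq_by_coefficients)
    fix a b
    have coeff: "tensor_lift (\<lambda>x y. Poly_Mapping.lookup x a * Poly_Mapping.lookup y b) u =
        tensor_lift (\<lambda>\<psi> \<chi>. dual_eval \<psi> (dq_M a) * dual_eval \<chi> (dq_M b)) (tensor_map dn_dual dn_dual u)" for u
      by (simp add: tensor_lift_map[OF bilinear_eval_product linear_dn_dual linear_dn_dual] dual_eval_dn_dual_M)
    show "tensor_lift (\<lambda>x y. Poly_Mapping.lookup x a * Poly_Mapping.lookup y b) s =
        tensor_lift (\<lambda>x y. Poly_Mapping.lookup x a * Poly_Mapping.lookup y b) (dn_comult x)"
      unfolding coeff ts[symmetric] using t by (simp add: dn_dual_comult_pairing)
  qed
  with ts show "t = tensor_map dn_dual dn_dual (dn_comult x)"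
    by simp
qed

lemma bihopf_iso_dn_dual: "bihopf_iso DNSym DQSym_dual dn_dual"
proof -
  have "hmult DQSym_dual = dual_mult" "hunit DQSym_dual = dual_unit" "hcomult DQSym_dual = dual_comult"
    "hcounit DQSym_dual = dual_counit"
    by (simp_all add: DQSym_dual_def)
  then show ?thesis
    by (simp add: bihopf_iso_def DNSym_simps linear_dn_dual bij_dn_dual dn_dual_mult dn_dual_1 dn_dual_comult
        dn_dual_counit dn_dual_comp)
qed

section \<open>Transport of the Hopf algebra axioms along an isomorphism\<close>

text \<open>Naturality of the associator.\<close>

lemma tensor_assoc_map:
  assumes f: "linearQ f" and g: "linearQ g" and h: "linearQ h"
  shows "tensor_assoc (tensor_map (tensor_map f g) h t) = tensor_map f (tensor_map g h) (tensor_assoc t)"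
proof (rule linear_eq_on_pure3[where t = t])
  show "linearQ (\<lambda>t. tensor_assoc (tensor_map (tensor_map f g) h t))"
    by (rule linearQ_compose[OF linear_tensor_assoc linear_tensor_map[OF linear_tensor_map[OF f g] h]])
  show "linearQ (\<lambda>t. tensor_map f (tensor_map g h) (tensor_assoc t))"
    by (rule linearQ_compose[OF linear_tensor_map[OF f linear_tensor_map[OF g h]] linear_tensor_assoc])
qed (simp add: tensor_map_pure tensor_assoc_pure linear_tensor_map f g h)

lemma lookup_map_linear: "linearQ f \<Longrightarrow> Poly_Mapping.lookup (Poly_Mapping.map f p) k = f (Poly_Mapping.lookup p k)"
  by (simp add: Poly_Mapping.map.rep_eq when_def linearQD)

context
  fixes H :: "'a::rat_vector bihopf" and K :: "'b::rat_vector bihopf" and \<phi>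
  assumes H: "bigraded_hopf_algebra H" and iso: "bihopf_iso H K \<phi>"
begin

interpretation H: bigraded_hopf_algebra H
  by (rule H)

lemma iso_linear: "linearQ \<phi>" and iso_bij: "bij \<phi>"
  and iso_mult: "hmult K (\<phi> x) (\<phi> y) = \<phi> (hmult H x y)"
  and iso_unit: "hunit K = \<phi> (hunit H)"
  and iso_comult: "hcomult K (\<phi> x) = tensor_map \<phi> \<phi> (hcomult H x)"
  and iso_counit: "hcounit K (\<phi> x) = hcounit H x"
  and iso_comp: "hcomp K d = \<phi> ` hcomp H d"
  using iso by (simp_all add: bihopf_iso_def del: split_paired_All)

lemma iso_inv: "\<phi> (inv \<phi> y) = y" "inv \<phi> (\<phi> x) = x"
  using iso_bij by (simp_all add: bij_is_surj surj_f_inv_f bij_is_inj)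

lemma linear_inv: "linearQ (inv \<phi>)"
proof (rule linearQI)
  show "inv \<phi> (x + y) = inv \<phi> x + inv \<phi> y" for x y
    by (metis iso_inv linearQD(1)[OF iso_linear])
  show "inv \<phi> (r *Q x) = r *Q inv \<phi> x" for r x
    by (metis iso_inv linearQD(2)[OF iso_linear])
qed

lemma iso_direct_sum:
  "\<exists>!c :: nat \<times> nat \<Rightarrow>\<^sub>0 'b. (\<forall>d. Poly_Mapping.lookup c d \<in> hcomp K d) \<and>
    y = (\<Sum>d\<in>Poly_Mapping.keys c. Poly_Mapping.lookup c d)"
proof -
  note iso_inv [simp]
  have keys: "Poly_Mapping.keys (Poly_Mapping.map \<phi> c) = Poly_Mapping.keys c" for c :: "nat \<times> nat \<Rightarrow>\<^sub>0 'a"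
    by (auto simp: in_keys_iff lookup_map_linear iso_linear linearQD) (metis iso_inv(2) linearQD(3)[OF iso_linear])
  have sum: "(\<Sum>d\<in>Poly_Mapping.keys (Poly_Mapping.map \<phi> c). Poly_Mapping.lookup (Poly_Mapping.map \<phi> c) d) =
      \<phi> (\<Sum>d\<in>Poly_Mapping.keys c. Poly_Mapping.lookup c d)" for c :: "nat \<times> nat \<Rightarrow>\<^sub>0 'a"
    by (simp add: keys lookup_map_linear iso_linear linearQ_sum)
  have comp: "\<phi> x \<in> hcomp K d \<longleftrightarrow> x \<in> hcomp H d" for x d
    by (simp add: iso_comp inj_image_mem_iff bij_is_inj iso_bij)
  have inj: "\<phi> x = \<phi> x' \<longleftrightarrow> x = x'" for x x'
    by (metis iso_inv(2))
  have surj: "\<exists>c'. c = Poly_Mapping.map \<phi> c'" for c :: "nat \<times> nat \<Rightarrow>\<^sub>0 'b"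
    by (rule exI[of _ "Poly_Mapping.map (inv \<phi>) c"], rule poly_mapping_eqI)
      (simp add: lookup_map_linear iso_linear linear_inv)
  let ?P = "\<lambda>c. (\<forall>d. Poly_Mapping.lookup c d \<in> hcomp H d) \<and>
    inv \<phi> y = (\<Sum>d\<in>Poly_Mapping.keys c. Poly_Mapping.lookup c d)"
  let ?Q = "\<lambda>c. (\<forall>d. Poly_Mapping.lookup c d \<in> hcomp K d) \<and> y = (\<Sum>d\<in>Poly_Mapping.keys c. Poly_Mapping.lookup c d)"
  have PQ: "?Q (Poly_Mapping.map \<phi> c) \<longleftrightarrow> ?P c" for c
    by (subst sum) (simp add: lookup_map_linear iso_linear comp, metis iso_inv)
  obtain c where c: "?P c" "\<And>c'. ?P c' \<Longrightarrow> c' = c"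
    using H.comp_direct_sum[of "inv \<phi> y"] by blast
  show ?thesis
    by (rule ex1I[of ?Q, OF PQ[THEN iffD2, OF c(1)]]) (metis surj PQ c(2))
qed

lemma bigraded_hopf_algebra_transport: "bigraded_hopf_algebra K"
proof (rule bigraded_hopf_algebra.intro)
  note iso_inv [simp]
  note lin = iso_linear linear_inv
  note tlin = linear_tensor_map[OF lin(1) lin(1)]
  have ex: "\<exists>x. y = \<phi> x" for y
    by (metis iso_inv(1))
  have mult: "hmult K = (\<lambda>x y. \<phi> (hmult H (inv \<phi> x) (inv \<phi> y)))"
    by (simp add: fun_eq_iff flip: iso_mult)
  show mult_K: "bilinearQ (hmult K)"
    unfolding mult by (rule bilinearQ_compose[OF H.mult_bilinear lin(2) lin(2) lin(1)])
  show "hmult K (hmult K x y) z = hmult K x (hmult K y z)" for x y z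
    by (simp add: mult H.mult_assoc)
  show "hmult K (hunit K) x = x" "hmult K x (hunit K) = x" for x
    by (simp_all add: mult iso_unit H.mult_unit)
  have comult: "hcomult K = (\<lambda>y. tensor_map \<phi> \<phi> (hcomult H (inv \<phi> y)))"
    by (simp add: fun_eq_iff flip: iso_comult)
  show comult_K: "linearQ (hcomult K)"
    unfolding comult by (rule linearQ_compose[OF tlin linearQ_compose[OF H.comult_linear lin(2)]])
  have counit: "hcounit K = (\<lambda>y. hcounit H (inv \<phi> y))"
    by (simp add: fun_eq_iff flip: iso_counit)
  show counit_K: "linearQ (hcounit K)"
    unfolding counit by (rule linearQ_compose[OF H.counit_linear lin(2)])
  show "tensor_assoc (tensor_map (hcomult K) id (hcomult K y)) = tensor_map id (hcomult K) (hcomult K y)" for y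
  proof -
    obtain x where y: "y = \<phi> x" using ex by blast
    let ?t = "hcomult H x"
    have "tensor_map (hcomult K) id (hcomult K y) = tensor_map (\<lambda>a. tensor_map \<phi> \<phi> (hcomult H a)) (\<lambda>a. \<phi> (id a)) ?t"
      by (simp only: y iso_comult tensor_map_map comult_K linearQ_id lin id_apply)
    also have "\<dots> = tensor_map (tensor_map \<phi> \<phi>) \<phi> (tensor_map (hcomult H) id ?t)"
      by (rule tensor_map_map[symmetric]) (rule tlin lin H.comult_linear linearQ_id)+
    also have "tensor_assoc \<dots> = tensor_map \<phi> (tensor_map \<phi> \<phi>) (tensor_map id (hcomult H) ?t)"
      by (simp only: tensor_assoc_map lin H.coassoc)
    also have "\<dots> = tensor_map (\<lambda>a. \<phi> (id a)) (\<lambda>a. tensor_map \<phi> \<phi> (hcomult H a)) ?t"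
      by (rule tensor_map_map) (rule tlin lin H.comult_linear linearQ_id)+
    also have "\<dots> = tensor_map id (hcomult K) (hcomult K y)"
      by (simp only: y iso_comult tensor_map_map comult_K linearQ_id lin id_apply)
    finally show ?thesis .
  qed
  have scale: "bilinearQ (\<lambda>a b. \<epsilon> a *Q b)" "bilinearQ (\<lambda>a b. \<epsilon> b *Q a)" if "linearQ \<epsilon>" for \<epsilon> :: "'c::rat_vector \<Rightarrow> rat"
    by (rule bilinearQI; simp add: linearQD[OF that] scaleQ_add_left scaleQ_add_right scaleQ_scaleQ
        scaleQ_rat_def mult.commute)+
  show "tensor_lift (\<lambda>a b. hcounit K a *Q b) (hcomult K y) = y" for y
  proof -
    obtain x where y: "y = \<phi> x" using ex by blast
    have "tensor_lift (\<lambda>a b. hcounit K a *Q b) (hcomult K y) = tensor_lift (\<lambda>a b. \<phi> (hcounit H a *Q b)) (hcomult H x)"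
      by (simp add: y iso_comult tensor_lift_map[OF scale(1)[OF counit_K] lin(1) lin(1)] iso_counit linearQD[OF lin(1)])
    also have "\<dots> = y"
      by (simp add: y H.counit_left flip: linear_tensor_lift_eq[OF scale(1)[OF H.counit_linear] lin(1)])
    finally show ?thesis .
  qed
  show "tensor_lift (\<lambda>a b. hcounit K b *Q a) (hcomult K y) = y" for y
  proof -
    obtain x where y: "y = \<phi> x" using ex by blast
    have "tensor_lift (\<lambda>a b. hcounit K b *Q a) (hcomult K y) = tensor_lift (\<lambda>a b. \<phi> (hcounit H b *Q a)) (hcomult H x)"
      by (simp add: y iso_comult tensor_lift_map[OF scale(2)[OF counit_K] lin(1) lin(1)] iso_counit linearQD[OF lin(1)])
    also have "\<dots> = y"
      by (simp add: y H.counit_right flip: linear_tensor_lift_eq[OF scale(2)[OF H.counit_linear] lin(1)])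
    finally show ?thesis .
  qed
  have tensor_mult: "tensor_map \<phi> \<phi> (tensor_mult (hmult H) (hmult H) s t) =
      tensor_mult (hmult K) (hmult K) (tensor_map \<phi> \<phi> s) (tensor_map \<phi> \<phi> t)" for s t
    by (rule tensor_map_mult) (rule H.mult_bilinear mult_K lin iso_mult[symmetric])+
  show "hcomult K (hmult K y z) = tensor_mult (hmult K) (hmult K) (hcomult K y) (hcomult K z)" for y z
  proof -
    obtain x w where "y = \<phi> x" "z = \<phi> w" using ex by blast
    then show ?thesis
      by (simp only: iso_mult iso_comult H.comult_mult tensor_mult)
  qed
  show "hcomult K (hunit K) = hunit K \<otimes> hunit K"
    by (simp add: iso_unit iso_comult H.comult_unit tensor_map_pure lin)
  show "hcounit K (hmult K x y) = hcounit K x * hcounit K y" for x y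
    by (simp add: counit mult H.counit_mult)
  show "hcounit K (hunit K) = 1"
    by (simp add: iso_unit iso_counit H.counit_unit)
  show "Q.subspace (hcomp K d)" for d
    unfolding iso_comp by (rule QQ.linear_subspace_image[OF lin(1) H.comp_subspace])
  show "hmult K x y \<in> hcomp K (d + e)" if "x \<in> hcomp K d" "y \<in> hcomp K e" for x y d e
    using that by (auto simp: iso_comp iso_mult intro!: imageI H.comp_mult)
  show "hunit K \<in> hcomp K 0"
    by (simp add: iso_comp iso_unit H.comp_unit)
  show "hcounit K x = 0" if "x \<in> hcomp K d" "d \<noteq> 0" for x d
    using that by (auto simp: iso_comp iso_counit H.comp_counit)
  show "hcomult K y \<in> Q.span {a \<otimes> b |a b. \<exists>e f. e + f = d \<and> a \<in> hcomp K e \<and> b \<in> hcomp K f}"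
    if y: "y \<in> hcomp K d" for y d
  proof -
    obtain x where x: "x \<in> hcomp H d" "y = \<phi> x"
      using y by (auto simp: iso_comp)
    let ?S = "{a \<otimes> b |a b. \<exists>e f. e + f = d \<and> a \<in> hcomp H e \<and> b \<in> hcomp H f}"
    have "hcomult K y \<in> tensor_map \<phi> \<phi> ` Q.span ?S"
      using H.comp_comult[OF x(1)] by (simp add: x(2) iso_comult)
    also have "tensor_map \<phi> \<phi> ` Q.span ?S = Q.span (tensor_map \<phi> \<phi> ` ?S)"
      by (rule QQ.linear_span_image[OF tlin, symmetric])
    also have "\<dots> \<subseteq> Q.span {a \<otimes> b |a b. \<exists>e f. e + f = d \<and> a \<in> hcomp K e \<and> b \<in> hcomp K f}"
    proof (rule Q.span_mono, rule image_subsetI)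
      fix t assume "t \<in> ?S"
      then obtain a b e f where "t = a \<otimes> b" "e + f = d" "a \<in> hcomp H e" "b \<in> hcomp H f"
        by blast
      moreover have "tensor_map \<phi> \<phi> (a \<otimes> b) = \<phi> a \<otimes> \<phi> b"
        by (rule tensor_map_pure[OF lin(1) lin(1)])
      ultimately show "tensor_map \<phi> \<phi> t \<in> {a \<otimes> b |a b. \<exists>e f. e + f = d \<and> a \<in> hcomp K e \<and> b \<in> hcomp K f}"
        unfolding iso_comp by blast
    qed
    finally show ?thesis .
  qed
  show "\<exists>S. linearQ S \<and> (\<forall>d. S ` hcomp K d \<subseteq> hcomp K d) \<and>
      (\<forall>x. tensor_lift (\<lambda>a b. hmult K (S a) b) (hcomult K x) = hcounit K x *Q hunit K) \<and>
      (\<forall>x. tensor_lift (\<lambda>a b. hmult K a (S b)) (hcomult K x) = hcounit K x *Q hunit K)"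
  proof -
    obtain S where S: "linearQ S" "\<And>d. S ` hcomp H d \<subseteq> hcomp H d"
      and left: "\<And>x. tensor_lift (\<lambda>a b. hmult H (S a) b) (hcomult H x) = hcounit H x *Q hunit H"
      and right: "\<And>x. tensor_lift (\<lambda>a b. hmult H a (S b)) (hcomult H x) = hcounit H x *Q hunit H"
      using H.antipode by blast
    define S' where "S' = (\<lambda>y. \<phi> (S (inv \<phi> y)))"
    have linS': "linearQ S'"
      unfolding S'_def by (rule linearQ_compose[OF lin(1) linearQ_compose[OF S(1) lin(2)]])
    have S': "S' (\<phi> x) = \<phi> (S x)" for x
      by (simp add: S'_def)
    have bilK: "bilinearQ (\<lambda>a b. hmult K (S' a) b)" "bilinearQ (\<lambda>a b. hmult K a (S' b))"
      using bilinearQ_compose[OF mult_K linS' linearQ_ident linearQ_ident]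
        bilinearQ_compose[OF mult_K linearQ_ident linS' linearQ_ident] by simp_all
    have bilH: "bilinearQ (\<lambda>a b. hmult H (S a) b)" "bilinearQ (\<lambda>a b. hmult H a (S b))"
      using bilinearQ_compose[OF H.mult_bilinear S(1) linearQ_ident linearQ_ident]
        bilinearQ_compose[OF H.mult_bilinear linearQ_ident S(1) linearQ_ident] by simp_all
    show ?thesis
    proof (intro exI[of _ S'] conjI allI linS')
      show "S' ` hcomp K d \<subseteq> hcomp K d" for d
        using S(2)[of d] by (auto simp: iso_comp S')
      fix y
      obtain x where y: "y = \<phi> x" using ex by blast
      show "tensor_lift (\<lambda>a b. hmult K (S' a) b) (hcomult K y) = hcounit K y *Q hunit K"
        unfolding y iso_comult tensor_lift_map[OF bilK(1) lin(1) lin(1)] S' iso_mult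
          linear_tensor_lift_eq[OF bilH(1) lin(1), symmetric] left
        by (simp add: linearQD[OF lin(1)] iso_counit iso_unit)
      show "tensor_lift (\<lambda>a b. hmult K a (S' b)) (hcomult K y) = hcounit K y *Q hunit K"
        unfolding y iso_comult tensor_lift_map[OF bilK(2) lin(1) lin(1)] S' iso_mult
          linear_tensor_lift_eq[OF bilH(2) lin(1), symmetric] right
        by (simp add: linearQD[OF lin(1)] iso_counit iso_unit)
    qed
  qed
qed (rule iso_direct_sum)

end

theorem theorem3p1: "bihopf_isomorphic DNSym DQSym_dual"
  unfolding bihopf_isomorphic_def
  using bigraded_hopf_algebra_DNSym bihopf_iso_dn_dual
    bigraded_hopf_algebra_transport[OF bigraded_hopf_algebra_DNSym bihopf_iso_dn_dual]
  by blast

end
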